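(* Let $0<\alpha\le1$ and $\delta>-1$, and let $(G_n)_{n\ge1}$ be a sequence of random graphs following the inverse power law de-preferential attachment model with $m=1$, exponent $\alpha$ and shift $\delta$. Let $v_i$ be a fixed vertex, and let $\lambda^*=\lambda^*(\alpha,\delta)>0$ be the unique root $\lambda$ of $$\sum_{n=1}^\infty\prod_{j=1}^{n}\frac{1}{(j+\delta)^\alpha\lambda+1}=1 .$$ Then, as $n\to\infty$: 1. The degree $d_i(n)$ of the fixed vertex $v_i$ in $G_n$ satisfies $$\frac{d_i(n)}{(\log n)^{\frac1{1+\alpha}}}\xrightarrow{a.s.}\left(\frac{1+\alpha}{\lambda^*}\right)^{\frac{1}{1+\alpha}}.$$ 2. Let $P_k(n)=\frac1n\sum_{j=1}^n\mathbf 1_{\{d_j(n)=k\}}$ be the fraction of vertices of degree $k$ in $G_n$. Then for every $k\ge1$, $$P_k(n)\xrightarrow{a.s.}\frac{(\delta+k)^\alpha\lambda^*}{(\delta+k)^\alpha\lambda^*+1}\prod_{j=1}^{k-1}\frac{1}{(\delta+j)^\alpha\lambda^*+1}.$$ 3. The probability that the half-edge $e_{n+1}$ of the new vertex $v_{n+1}$ is attached to $v_i$ and that $v_i$ has degree $k$ in $G_n$ satisfies $$P\big(e_{n+1}=\{v_{n+1},v_i\},\ d_i(n)=k\big)\to\prod_{j=1}^{k-1}\frac{1}{(\delta+j)^\alpha\lambda^*+1}.$$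
   Context: Inverse power law de-preferential attachment model with $m=1$, exponent $\alpha>0$ and shift $\delta>-1$. The graph $G_n$ has vertices $v_1,\dots,v_n$. Initially there is one vertex $v_1$ carrying one half-edge, so $d_1(1)=1$. At each time $n\ge1$ a new vertex $v_{n+1}$ arrives with one half-edge $e_{n+1}$, which is attached to one of $v_1,\dots,v_n$; the resulting graph is $G_{n+1}$. Write $d_j(n)$ for the degree (in-degree plus out-degree) of $v_j$ in $G_n$, so $d_{n+1}(n+1)=1$, and $\mathcal F_n$ for the natural filtration of the graph sequence. Then $$P(e_{n+1}=\{v_{n+1},v_j\}\mid\mathcal F_n)=\frac{C_n}{(\delta+d_j(n))^\alpha},\qquad C_n^{-1}=\sum_{l=1}^n\frac{1}{(\delta+d_l(n))^\alpha},\qquad j=1,\dots,n.$$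
   Formalization: Item 3 is corrected: the event is that e_{n+1} attaches to some vertex having degree k in G_n (not to a fixed v_i), and the product runs to k, not k-1. As printed it fails: for fixed v_i the probability tends to 0, and the printed limits sum to 2 over k. *)

theory Defs
  imports "HOL-Probability.Probability"
begin

text \<open>
  The graph sequence is encoded by its half-edges: \<open>e m \<omega>\<close> is the set of indices of the end points
  of the edge brought in by the vertex \<open>m\<close>, and the graph at time \<open>n\<close> consists of the vertices
  \<open>1, \<dots>, n\<close> and of \<open>e 1 \<omega>, \<dots>, e n \<omega>\<close>.  The half-edge \<open>e 1 \<omega> = {1}\<close> of the initial vertex is
  dangling but contributes to its degree.
\<close>

definition vdeg :: "(nat \<Rightarrow> 'w \<Rightarrow> nat set) \<Rightarrow> nat \<Rightarrow> nat \<Rightarrow> 'w \<Rightarrow> nat" where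
  "vdeg e j n \<omega> = card {m \<in> {1..n}. j \<in> e m \<omega>}"

definition graph_filtration ::
  "'w measure \<Rightarrow> (nat \<Rightarrow> 'w \<Rightarrow> nat set) \<Rightarrow> nat \<Rightarrow> 'w measure" where
  "graph_filtration M e n = sigma (space M) {e m -` S \<inter> space M | m S. m \<in> {1..n}}"

definition attach_normalizer ::
  "real \<Rightarrow> real \<Rightarrow> (nat \<Rightarrow> 'w \<Rightarrow> nat set) \<Rightarrow> nat \<Rightarrow> 'w \<Rightarrow> real" where
  "attach_normalizer \<alpha> \<delta> e n \<omega> =
     inverse (\<Sum>l=1..n. 1 / (\<delta> + real (vdeg e l n \<omega>)) powr \<alpha>)"

definition inverse_power_depref_attachment ::
  "'w measure \<Rightarrow> real \<Rightarrow> real \<Rightarrow> (nat \<Rightarrow> 'w \<Rightarrow> nat set) \<Rightarrow> bool" where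
  "inverse_power_depref_attachment M \<alpha> \<delta> e \<longleftrightarrow>
     prob_space M \<and>
     (\<forall>n\<ge>1. e n \<in> measurable M (count_space UNIV)) \<and>
     (\<forall>\<omega>\<in>space M. e 1 \<omega> = {1}) \<and>
     (\<forall>\<omega>\<in>space M. \<forall>n\<ge>1. \<exists>j\<in>{1..n}. e (Suc n) \<omega> = {Suc n, j}) \<and>
     (\<forall>n\<ge>1. \<forall>j\<in>{1..n}. AE \<omega> in M.
        real_cond_exp M (graph_filtration M e n)
          (indicator {\<omega> \<in> space M. e (Suc n) \<omega> = {Suc n, j}}) \<omega>
        = attach_normalizer \<alpha> \<delta> e n \<omega> / (\<delta> + real (vdeg e j n \<omega>)) powr \<alpha>)"

definition degree_fraction ::
  "(nat \<Rightarrow> 'w \<Rightarrow> nat set) \<Rightarrow> nat \<Rightarrow> nat \<Rightarrow> 'w \<Rightarrow> real" where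
  "degree_fraction e k n \<omega> = (1 / real n) * (\<Sum>j=1..n. of_bool (vdeg e j n \<omega> = k))"

text \<open>The equation for the rate, with the summation index shifted to start at \<open>0\<close>.\<close>

definition is_rate :: "real \<Rightarrow> real \<Rightarrow> real \<Rightarrow> bool" where
  "is_rate \<alpha> \<delta> r \<longleftrightarrow>
     r > 0 \<and> (\<lambda>n. \<Prod>j=1..Suc n. 1 / ((real j + \<delta>) powr \<alpha> * r + 1)) sums 1"

definition rate :: "real \<Rightarrow> real \<Rightarrow> real" where
  "rate \<alpha> \<delta> = (THE r. is_rate \<alpha> \<delta> r)"

end

theory Submission
  imports Defs "HOL-Library.Discrete_Functions"
begin

text \<open>
  Let \<open>w k = 1 / (\<delta> + k) powr \<alpha>\<close>, let \<open>S n\<close> be the total weight of the vertices of the \<open>n\<close>-th graph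
  and \<open>T k n\<close> the number of vertices of degree at least \<open>k\<close>.  Up to bounded martingale differences,
  \<open>T (k + 1)\<close> increases at rate \<open>w k * (T k - T (k + 1)) / S\<close>.  Hence an asymptotic upper bound
  \<open>S n \<le> b * n\<close> forces asymptotic lower bounds \<open>T (k + 1) n \<ge> surv k b * n\<close>, and vice versa.  As \<open>w\<close> is
  decreasing, \<open>S\<close> is a decreasing function of the tails \<open>T\<close> (summation by parts), so that with
  \<open>b = limsup S n / n\<close> and \<open>a = liminf S n / n\<close> one gets \<open>b \<le> b * char_sum b\<close> and
  \<open>a \<ge> a * char_sum a\<close>.  As \<open>char_sum\<close> is decreasing with value \<open>1\<close> at the rate, both limits are
  equal to the rate, and the degree fractions follow.

  For a fixed vertex of degree \<open>D n\<close>, the sum of \<open>(\<delta> + j) powr \<alpha>\<close> over \<open>j < D n\<close> minus the sum of \<open>1 / S m\<close>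
  over \<open>m < n\<close> is a martingale with second moment \<open>O((ln n) powr (3/2))\<close>, hence \<open>o(ln n)\<close> along a sparse
  sequence of times, and monotonicity fills the gaps.
\<close>

text \<open>The obstacle is that tails and total weight feed each other: \<open>T (k + 1)\<close> is
  driven by \<open>S\<close>, while \<open>S\<close> depends on all tails at once, so neither has a
  limit a priori. Order replaces compactness: all estimates are one-sided, and only finitely many
  levels enter at a time, since \<open>w k\<close> tends to 0 and truncating the weight at level
  \<open>K\<close> costs at most \<open>w K * n\<close>. A positive linear lower bound for
  \<open>S\<close> is needed to start; it comes from the degrees having sum at most
  \<open>2 * n\<close>. The fixed vertex lives on the scale \<open>ln n\<close>, where an error o(n)
  is worthless. Its degree is transformed by partial sums of \<open>f\<close> because a jump of size
  \<open>f d\<close> that occurs with probability \<open>w d / S\<close> has mean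
  \<open>1 / S\<close>, whatever \<open>d\<close> is. The price is jumps that grow with the degree.
  Their variance at time \<open>m\<close> is of order \<open>f d / m\<close>; since
  \<open>(f d)\<^sup>2\<close> is at most a constant times 1 plus the transformed degree, whose mean
  is O(\<open>ln n\<close>), the mean of \<open>f d\<close> is O(\<open>sqrt (ln n)\<close>), and
  summing against \<open>1 / m\<close> yields the exponent 3/2.\<close>

section \<open>Real sequences\<close>

text \<open>The line \<open>x n = q * n\<close> balances the drift when
  \<open>q = a - c * q\<close>, that is at \<open>q = a / (1 + c)\<close>. After subtracting the
  accumulated noise and a slightly lower line, the remainder is multiplied by at least
  \<open>1 - c / n\<close> in each step, so it cannot drift to minus infinity. Of the noise, only
  its vanishing average matters.\<close>

lemma drift_lower_bound:
  fixes x \<xi> :: "nat \<Rightarrow> real"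
  assumes c: "0 \<le> c"
    and noise: "(\<lambda>n. (\<Sum>m<n. \<xi> m) / real n) \<longlonglongrightarrow> 0"
    and drift: "\<forall>\<^sub>F n in sequentially. x (Suc n) \<ge> x n + a - c * x n / real n + \<xi> n"
    and q: "q < a / (1 + c)"
  shows "\<forall>\<^sub>F n in sequentially. q < x n / real n"
proof -
  define E where "E n = (\<Sum>m<n. \<xi> m)" for n
  define \<eta> where "\<eta> = a / (1 + c) - q"
  \<comment> \<open>Halfway between \<open>q\<close> and the equilibrium: the gap above
    \<open>q'\<close> pays for the noise in the recursion, the gap below it for the errors in the
    final estimate.\<close>
  define q' where "q' = q + \<eta> / 2"
  have \<eta>: "\<eta> > 0" using q by (simp add: \<eta>_def)
  have q'a: "q' * (1 + c) = a - \<eta> / 2 * (1 + c)"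
    using c by (simp add: q'_def \<eta>_def field_simps)
  \<comment> \<open>The final estimate loses \<open>\<epsilon>\<close> twice, once for the noise and
    once for the bounded remainder, and \<open>q' - 2 * \<epsilon> = q\<close>.\<close>
  define \<epsilon> where "\<epsilon> = \<eta> / 4"
  have \<epsilon>: "\<epsilon> > 0" using \<eta> by (simp add: \<epsilon>_def)
  have evE: "\<forall>\<^sub>F n in sequentially. \<bar>E n / real n\<bar> < \<epsilon>"
    using tendstoD[OF noise \<epsilon>] by (simp add: E_def dist_real_def)
  define z where "z n = x n - E n - q' * real n" for n
  have "\<forall>\<^sub>F n in sequentially. z (Suc n) \<ge> (1 - c / real n) * z n \<and> c < real n \<and> 0 < n"
    using drift evE eventually_gt_at_top[of "nat \<lceil>c\<rceil>"] eventually_gt_at_top[of 0]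
  proof eventually_elim
    case (elim n)
    have cn: "c < real n" using elim(3) by linarith
    have n: "real n > 0" using elim(4) by simp
    have "z (Suc n) = x (Suc n) - E n - \<xi> n - q' * real n - q'"
      by (simp add: z_def E_def algebra_simps)
    also have "\<dots> \<ge> x n + a - c * x n / real n - E n - q' * real n - q'"
      using elim(1) by linarith
    finally have "z (Suc n) \<ge> z n + a - c * x n / real n - q'" by (simp add: z_def)
    moreover have "c * x n / real n = c * z n / real n + c * (E n / real n) + c * q'"
      using n by (simp add: z_def field_simps)
    moreover have "c * (E n / real n) \<le> c * \<epsilon>"
      using c by (rule mult_left_mono[rotated]) (use elim(2) in linarith)
    moreover have "a - c * q' - q' = \<eta> / 2 * (1 + c)" using q'a unfolding distrib_left by (simp add: mult.commute)
    moreover have "c * \<epsilon> \<le> \<eta> / 2 * (1 + c)" using \<eta> c by (simp add: \<epsilon>_def algebra_simps)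
    ultimately have "z (Suc n) \<ge> z n - c * z n / real n" by linarith
    then show ?case using cn elim(4) by (simp add: algebra_simps)
  qed
  then obtain N where N: "\<And>n. n \<ge> N \<Longrightarrow> z (Suc n) \<ge> (1 - c / real n) * z n \<and> c < real n \<and> 0 < n"
    by (auto simp: eventually_sequentially)
  \<comment> \<open>The factor \<open>1 - c / n\<close> lies in [0, 1], so it keeps a nonnegative
    lower bound nonnegative and moves a negative one towards 0.\<close>
  have zlow: "z n \<ge> min (z N) 0" if "n \<ge> N" for n
    using that
  proof (induction n rule: dec_induct)
    case base then show ?case by simp
  next
    case (step n)
    have n: "z (Suc n) \<ge> (1 - c / real n) * z n" "c < real n" "0 < n" using N step by auto
    have f: "0 \<le> 1 - c / real n" "1 - c / real n \<le> 1" using n c by auto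
    have "(1 - c / real n) * z n \<ge> (1 - c / real n) * min (z N) 0"
      using f step by (intro mult_left_mono) auto
    moreover have "(1 - c / real n) * min (z N) 0 \<ge> 1 * min (z N) 0"
      using f by (intro mult_right_mono_neg) auto
    ultimately show ?case using n by linarith
  qed
  have "(\<lambda>n. min (z N) 0 / real n) \<longlonglongrightarrow> 0" by (rule lim_const_over_n)
  from tendstoD[OF this \<epsilon>] have "\<forall>\<^sub>F n in sequentially. \<bar>min (z N) 0 / real n\<bar> < \<epsilon>"
    by (simp only: dist_real_def diff_0_right)
  then show ?thesis
    using evE eventually_ge_at_top[of N] eventually_gt_at_top[of 0]
  proof eventually_elim
    case (elim n)
    have "x n / real n = z n / real n + E n / real n + q'"
      using elim(4) by (simp add: z_def field_simps)
    moreover have "z n / real n \<ge> min (z N) 0 / real n"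
      using zlow[OF elim(3)] by (intro divide_right_mono) auto
    ultimately have "x n / real n > q' - \<epsilon> - \<epsilon>" using elim(1,2) by linarith
    then show ?case by (simp add: q'_def \<epsilon>_def)
  qed
qed

text \<open>A Cesaro mean with weights \<open>1 / m\<close>, whose total is asymptotic to
  \<open>ln n\<close>. It serves to sum \<open>1 / S m = (m / S m) / m\<close>, where
  \<open>m / S m\<close> converges.\<close>

lemma log_weighted_average:
  fixes c :: "nat \<Rightarrow> real"
  assumes "c \<longlonglongrightarrow> l"
  shows "(\<lambda>n. (\<Sum>m=N..<n. c m / real m) / ln (real n)) \<longlonglongrightarrow> l"
proof -
  have harm: "(\<lambda>n. (\<Sum>m=1..<n. 1 / real m) / ln (real n)) \<longlonglongrightarrow> 1"
  proof -
    obtain g where g: "(\<lambda>n. harm n - ln (real n)) \<longlonglongrightarrow> g"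
      using euler_mascheroni_convergent unfolding convergent_def by auto
    have lninf: "filterlim (\<lambda>n. ln (real n)) at_top sequentially" by (rule filterlim_compose[OF ln_at_top filterlim_real_sequentially])
    have "(\<lambda>n. 1 + ((harm n - ln (real n)) - 1 / real n) / ln (real n)) \<longlonglongrightarrow> 1 + 0"
      by (intro tendsto_add tendsto_const tendsto_divide_0[where c = "g - 0"] tendsto_diff g lim_1_over_n
            filterlim_at_top_imp_at_infinity lninf)
    moreover have "\<forall>\<^sub>F n in sequentially.
        1 + ((harm n - ln (real n)) - 1 / real n) / ln (real n) = (\<Sum>m=1..<n. 1 / real m) / ln (real n)"
      using eventually_gt_at_top[of 1]
    proof eventually_elim
      case (elim n)
      have "{1..n} = insert n {1..<n}" using elim by auto
      then have "harm n = 1 / real n + (\<Sum>m=1..<n. 1 / real m)"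
        by (simp add: harm_def inverse_eq_divide)
      then show ?case using elim by (simp add: field_simps)
    qed
    ultimately show ?thesis by (auto intro: Lim_transform_eventually)
  qed
  show ?thesis
  proof (rule LIMSEQ_I)
    fix r :: real assume r: "r > 0"
    define h where "h n = (\<Sum>m=1..<n. 1 / real m)" for n
    define \<epsilon> where "\<epsilon> = r / 4"
    have \<epsilon>: "\<epsilon> > 0" using r by (simp add: \<epsilon>_def)
    obtain K0 where K0: "\<And>m. m \<ge> K0 \<Longrightarrow> \<bar>c m - l\<bar> < \<epsilon>"
      using LIMSEQ_D[OF assms \<epsilon>] by auto
    define K where "K = Max {K0, N, 1}"
    have K: "K \<ge> K0" "K \<ge> N" "K \<ge> 1" by (auto simp: K_def)
    define C where "C = \<bar>(\<Sum>m=N..<K. c m / real m) - l * h K\<bar>"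
    have bnd: "\<bar>(\<Sum>m=N..<n. c m / real m) - l * h n\<bar> \<le> C + \<epsilon> * h n" if n: "n \<ge> K" for n
    proof -
      have "(\<Sum>m=N..<n. c m / real m) = (\<Sum>m=N..<K. c m / real m) + (\<Sum>m=K..<n. c m / real m)"
        using K n by (simp add: sum.atLeastLessThan_concat)
      moreover have hs: "h n = h K + (\<Sum>m=K..<n. 1 / real m)"
        unfolding h_def using K n by (simp add: sum.atLeastLessThan_concat)
      ultimately have "(\<Sum>m=N..<n. c m / real m) - l * h n =
          ((\<Sum>m=N..<K. c m / real m) - l * h K) + (\<Sum>m=K..<n. (c m - l) / real m)"
        by (simp add: algebra_simps sum_distrib_left sum_subtractf diff_divide_distrib)
      also have "\<bar>\<dots>\<bar> \<le> C + (\<Sum>m=K..<n. \<bar>(c m - l) / real m\<bar>)"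
        unfolding C_def by (rule order.trans[OF abs_triangle_ineq]) (intro add_left_mono sum_abs)
      also have "(\<Sum>m=K..<n. \<bar>(c m - l) / real m\<bar>) \<le> (\<Sum>m=K..<n. \<epsilon> * (1 / real m))"
      proof (intro sum_mono)
        fix m assume "m \<in> {K..<n}"
        then have "\<bar>c m - l\<bar> \<le> \<epsilon>" using K0[of m] K by auto
        then show "\<bar>(c m - l) / real m\<bar> \<le> \<epsilon> * (1 / real m)"
          by (simp add: divide_right_mono)
      qed
      also have "\<dots> = \<epsilon> * (\<Sum>m=K..<n. 1 / real m)" by (simp add: sum_distrib_left)
      also have "\<dots> \<le> \<epsilon> * h n"
        using \<epsilon> hs by (intro mult_left_mono) (auto simp: h_def intro: sum_nonneg)
      finally show ?thesis by simp
    qed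
    have lninf: "filterlim (\<lambda>n. ln (real n)) at_top sequentially" by (rule filterlim_compose[OF ln_at_top filterlim_real_sequentially])
    have lim: "(\<lambda>n. C / ln (real n) + \<epsilon> * (h n / ln (real n)) + \<bar>l\<bar> * \<bar>h n / ln (real n) - 1\<bar>)
       \<longlonglongrightarrow> 0 + \<epsilon> * 1 + \<bar>l\<bar> * \<bar>1 - 1\<bar>"
      unfolding h_def
      by (intro tendsto_intros harm tendsto_divide_0[where c = C] filterlim_at_top_imp_at_infinity lninf)
    have "\<forall>\<^sub>F n in sequentially.
        C / ln (real n) + \<epsilon> * (h n / ln (real n)) + \<bar>l\<bar> * \<bar>h n / ln (real n) - 1\<bar> < r"
      using order_tendstoD(2)[OF lim, of r] r by (simp add: \<epsilon>_def)
    then have "\<forall>\<^sub>F n in sequentially. norm ((\<Sum>m=N..<n. c m / real m) / ln (real n) - l) < r"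
      using eventually_ge_at_top[of K] eventually_gt_at_top[of 1]
    proof eventually_elim
      case (elim n)
      define s where "s = (\<Sum>m=N..<n. c m / real m)"
      define L where "L = ln (real n)"
      have L: "L > 0" using elim by (simp add: L_def)
      have "s / L - l = (s - l * h n) / L + l * (h n / L - 1)" using L by (simp add: field_simps)
      also have "\<bar>\<dots>\<bar> \<le> \<bar>(s - l * h n) / L\<bar> + \<bar>l * (h n / L - 1)\<bar>" by (rule abs_triangle_ineq)
      also have "\<dots> = \<bar>s - l * h n\<bar> / L + \<bar>l\<bar> * \<bar>h n / L - 1\<bar>" using L by (simp add: abs_mult)
      also have "\<bar>s - l * h n\<bar> / L \<le> (C + \<epsilon> * h n) / L"
        using bnd[OF elim(2)] L by (intro divide_right_mono) (auto simp: s_def)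
      also have "(C + \<epsilon> * h n) / L = C / L + \<epsilon> * (h n / L)" by (simp add: add_divide_distrib)
      finally have "\<bar>s / L - l\<bar> < r" using elim(1) by (simp add: L_def)
      then show ?case by (simp add: s_def L_def)
    qed
    then show "\<exists>no. \<forall>n\<ge>no. norm ((\<Sum>m=N..<n. c m / real m) / ln (real n) - l) < r"
      by (simp add: eventually_sequentially)
  qed
qed

text \<open>Between two consecutive times of \<open>s\<close>, monotonicity bounds numerator and
  denominator by their values at the two ends. The resulting bounds differ from the subsequence
  ratios only by factors \<open>l (s (Suc m)) / l (s m)\<close>, which tend to 1.\<close>

lemma tendsto_sandwich_subseq:
  fixes x l :: "nat \<Rightarrow> real"
  assumes x: "mono x" and l: "mono l" and x0: "x 0 \<ge> 0"
    and s: "strict_mono (s :: nat \<Rightarrow> nat)"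
    and pos: "\<And>m. l (s m) > 0"
    and ratio: "(\<lambda>m. l (s (Suc m)) / l (s m)) \<longlonglongrightarrow> 1"
    and lim: "(\<lambda>m. x (s m) / l (s m)) \<longlonglongrightarrow> L"
  shows "(\<lambda>n. x n / l n) \<longlonglongrightarrow> L"
proof -
  \<comment> \<open>The index of the last time of \<open>s\<close> up to \<open>n\<close>. For
    \<open>n < s 0\<close> there is none and the value is unspecified, so every use is restricted to
    \<open>n \<ge> s 0\<close>.\<close>
  define g where "g n = (GREATEST m. s m \<le> n)" for n
  have g: "s (g n) \<le> n" "n < s (Suc (g n))" if "n \<ge> s 0" for n
  proof -
    have b: "\<forall>m. s m \<le> n \<longrightarrow> m \<le> n" using s by (meson le_trans seq_suble)
    show "s (g n) \<le> n" unfolding g_def using b that by (intro GreatestI_nat[where P="\<lambda>m. s m \<le> n" and k=0 and b=n]) auto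
    show "n < s (Suc (g n))"
    proof (rule ccontr)
      assume "\<not> ?thesis"
      then have "Suc (g n) \<le> g n" unfolding g_def using b
        by (intro Greatest_le_nat[where P="\<lambda>m. s m \<le> n" and b=n]) auto
      then show False by simp
    qed
  qed
  have ginf: "filterlim g at_top sequentially"
    unfolding filterlim_at_top
  proof
    fix Z
    show "\<forall>\<^sub>F n in sequentially. Z \<le> g n"
      using eventually_ge_at_top[of "s 0"] eventually_ge_at_top[of "s Z"]
    proof eventually_elim
      case (elim n)
      have "s Z < s (Suc (g n))" using g(2)[OF elim(1)] elim(2) by linarith
      then show ?case using s by (simp add: strict_mono_less)
    qed
  qed
  have xnn: "x n \<ge> 0" for n using monoD[OF x, of 0 n] x0 by simp
  define lo where "lo m = (x (s m) / l (s m)) / (l (s (Suc m)) / l (s m))" for m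
  define hi where "hi m = (x (s (Suc m)) / l (s (Suc m))) * (l (s (Suc m)) / l (s m))" for m
  have lo: "lo \<longlonglongrightarrow> L" unfolding lo_def using tendsto_divide[OF lim ratio] by simp
  have hi: "hi \<longlonglongrightarrow> L" unfolding hi_def
    using tendsto_mult[OF LIMSEQ_Suc[OF lim] ratio] by simp
  show ?thesis
  proof (rule tendsto_sandwich[OF _ _ filterlim_compose[OF lo ginf] filterlim_compose[OF hi ginf]])
    show "\<forall>\<^sub>F n in sequentially. lo (g n) \<le> x n / l n"
      using eventually_ge_at_top[of "s 0"]
    proof eventually_elim
      case (elim n)
      have p: "l (s (g n)) > 0" "l (s (Suc (g n))) > 0" using pos by auto
      have "l (s (g n)) \<le> l n" "l n \<le> l (s (Suc (g n)))" "x (s (g n)) \<le> x n"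
        using g[OF elim] by (simp_all add: monoD[OF l] monoD[OF x])
      with p have "x (s (g n)) / l (s (Suc (g n))) \<le> x n / l n"
        using xnn[of n] by (meson frac_le less_le_trans)
      then show ?case using p by (simp add: lo_def)
    qed
    show "\<forall>\<^sub>F n in sequentially. x n / l n \<le> hi (g n)"
      using eventually_ge_at_top[of "s 0"]
    proof eventually_elim
      case (elim n)
      have p: "l (s (g n)) > 0" "l (s (Suc (g n))) > 0" using pos by auto
      have "l (s (g n)) \<le> l n" "l n \<le> l (s (Suc (g n)))" "x n \<le> x (s (Suc (g n)))"
        using g[OF elim] by (simp_all add: monoD[OF l] monoD[OF x])
      with p have "x n / l n \<le> x (s (Suc (g n))) / l (s (g n))"
        using xnn[of "s (Suc (g n))"] by (meson frac_le)
      then show ?case using p by (simp add: hi_def)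
    qed
  qed
qed

section \<open>The characteristic equation\<close>

locale depref_params =
  fixes \<alpha> \<delta> :: real
  assumes alpha_pos: "0 < \<alpha>" and alpha_le_1: "\<alpha> \<le> 1" and delta_gt: "-1 < \<delta>"
begin

definition f :: "nat \<Rightarrow> real" where "f k = (\<delta> + real k) powr \<alpha>"

definition w :: "nat \<Rightarrow> real" where "w k = 1 / f k"

text \<open>If the total weight were exactly \<open>r * n\<close>, a vertex of degree
  \<open>j\<close> would gain an edge at rate \<open>w j / r\<close> in the time scale
  \<open>ln n\<close>, and the age of a uniformly chosen vertex would be asymptotically exponential
  with mean 1 in that scale. The factor \<open>1 / (f j * r + 1) = (w j / r) / (1 + w j / r)\<close>
  is the chance that the edge comes before the age runs out, so \<open>surv k r\<close> is the
  limiting proportion of degrees above \<open>k\<close>.\<close>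

definition surv :: "nat \<Rightarrow> real \<Rightarrow> real" where
  "surv k r = (\<Prod>j=1..k. 1 / (f j * r + 1))"

definition char_sum :: "real \<Rightarrow> real" where
  "char_sum r = (\<Sum>k. surv (Suc k) r)"

lemma shifted_pos: "k \<ge> 1 \<Longrightarrow> 0 < \<delta> + real k"
  using delta_gt by linarith

lemma f_nonneg: "0 \<le> f k"
  by (simp add: f_def)

lemma f_pos: "k \<ge> 1 \<Longrightarrow> 0 < f k"
  using shifted_pos[of k] by (simp add: f_def)

lemma f_mono: "1 \<le> j \<Longrightarrow> j \<le> k \<Longrightarrow> f j \<le> f k"
  unfolding f_def using shifted_pos[of j] alpha_pos by (intro powr_mono2) auto

lemma w_nonneg: "0 \<le> w k"
  by (simp add: w_def f_nonneg)

lemma w_pos: "k \<ge> 1 \<Longrightarrow> 0 < w k"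
  by (simp add: w_def f_pos)

lemma w_antimono: "1 \<le> j \<Longrightarrow> j \<le> k \<Longrightarrow> w k \<le> w j"
  unfolding w_def using f_pos[of j] f_mono[of j k] by (simp add: frac_le)

lemma w_f: "k \<ge> 1 \<Longrightarrow> w k * f k = 1"
  using f_pos[of k] by (simp add: w_def)

lemma f_at_top: "filterlim f at_top sequentially"
proof -
  have "filterlim (\<lambda>k. (\<delta> + real k) powr \<alpha>) at_top sequentially"
    unfolding filterlim_at_top
  proof
    fix Z :: real
    show "\<forall>\<^sub>F k in sequentially. Z \<le> (\<delta> + real k) powr \<alpha>"
      using eventually_ge_at_top[of "nat \<lceil>max Z 1 powr (1 / \<alpha>) - \<delta>\<rceil>"]
    proof eventually_elim
      case (elim k)
      have "Z \<le> (max Z 1 powr (1 / \<alpha>)) powr \<alpha>" using alpha_pos by (simp add: powr_powr)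
      also have "\<dots> \<le> (\<delta> + real k) powr \<alpha>"
        using elim alpha_pos by (intro powr_mono2) (simp_all add: diff_le_eq add.commute)
      finally show ?case .
    qed
  qed
  then show ?thesis by (simp add: f_def[abs_def])
qed

lemma w_tendsto_0: "w \<longlonglongrightarrow> 0"
  unfolding w_def[abs_def]
  by (rule tendsto_divide_0[OF tendsto_const filterlim_at_top_imp_at_infinity[OF f_at_top]])

lemma surv_0 [simp]: "surv 0 r = 1"
  by (simp add: surv_def)

lemma surv_Suc: "surv (Suc k) r = surv k r / (f (Suc k) * r + 1)"
  by (simp add: surv_def)

lemma surv_pos: "0 \<le> r \<Longrightarrow> 0 < surv k r"
  unfolding surv_def by (intro prod_pos) (auto simp: add_nonneg_pos f_nonneg)

text \<open>The balance equation of the tail recursion: \<open>surv k r - surv (Suc k) r\<close> is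
  the proportion of degree exactly \<open>Suc k\<close>, and the flow out of this level, divided by
  the weight \<open>r\<close>, sustains the next tail. Its telescoping right-hand side is what makes
  the series tractable.\<close>

lemma surv_step: "0 \<le> r \<Longrightarrow> r * surv (Suc k) r = w (Suc k) * (surv k r - surv (Suc k) r)"
proof -
  assume r: "0 \<le> r"
  have f: "f (Suc k) > 0" by (rule f_pos) simp
  have "f (Suc k) * r + 1 > 0" using f r by (simp add: add_nonneg_pos)
  then have "surv k r - surv (Suc k) r = f (Suc k) * (r * surv (Suc k) r)"
    by (simp add: surv_Suc divide_simps) (simp add: algebra_simps)
  then have "w (Suc k) * (surv k r - surv (Suc k) r) = (w (Suc k) * f (Suc k)) * (r * surv (Suc k) r)"
    by (simp only: mult.assoc)
  then show ?thesis by (simp add: w_f)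
qed

lemma surv_antimono_index: "0 \<le> r \<Longrightarrow> surv (Suc k) r \<le> surv k r"
proof -
  assume r: "0 \<le> r"
  have "0 \<le> r * surv (Suc k) r"
    using r surv_pos[OF r, of "Suc k"] by (intro mult_nonneg_nonneg) linarith+
  then have "0 \<le> surv k r - surv (Suc k) r"
    unfolding surv_step[OF r] using w_pos[of "Suc k"] by (simp add: zero_le_mult_iff)
  then show ?thesis by linarith
qed

lemma surv_le_1: "0 \<le> r \<Longrightarrow> surv k r \<le> 1"
  by (induction k) (auto intro: order.trans[OF surv_antimono_index])

lemma surv_antimono: "0 \<le> r \<Longrightarrow> r \<le> s \<Longrightarrow> surv k s \<le> surv k r"
  unfolding surv_def
  by (intro prod_mono) (auto intro!: frac_le mult_left_mono add_nonneg_pos simp: f_nonneg)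

lemma surv_1_strict: "0 < r \<Longrightarrow> r < s \<Longrightarrow> surv (Suc 0) s < surv (Suc 0) r"
  using f_pos[of 1] by (auto simp: surv_def intro!: divide_strict_left_mono mult_pos_pos add_pos_pos)

text \<open>Summing the balance equation with every \<open>w (Suc k)\<close> replaced by the largest
  weight \<open>w 1\<close> telescopes. This gives summability without estimating how fast the
  products decay.\<close>

lemma surv_partial_sum_bound:
  assumes r: "0 \<le> r"
  shows "r * (\<Sum>k<K. surv (Suc k) r) \<le> w 1"
proof -
  have "r * (\<Sum>k<K. surv (Suc k) r) = (\<Sum>k<K. w (Suc k) * (surv k r - surv (Suc k) r))"
    by (simp add: sum_distrib_left surv_step r)
  also have "\<dots> \<le> (\<Sum>k<K. w 1 * (surv k r - surv (Suc k) r))"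
    using surv_antimono_index[OF r] by (intro sum_mono mult_right_mono w_antimono) auto
  also have "\<dots> = w 1 * (surv 0 r - surv K r)"
    using sum_lessThan_telescope'[of "\<lambda>k. surv k r" K] by (simp add: sum_distrib_left[symmetric])
  also have "\<dots> \<le> w 1 * 1"
    using surv_pos[OF r, of K] by (intro mult_left_mono w_nonneg) simp
  finally show ?thesis by simp
qed

lemma surv_summable:
  assumes r: "0 < r"
  shows "summable (\<lambda>k. surv (Suc k) r)"
proof (rule bounded_imp_summable[where B = "w 1 / r"])
  show "(\<Sum>k\<le>n. surv (Suc k) r) \<le> w 1 / r" for n
    using surv_partial_sum_bound[of r "Suc n"] r by (simp add: lessThan_Suc_atMost field_simps)
  show "0 \<le> surv (Suc n) r" for n
    using surv_pos[of r "Suc n"] r by simp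
qed

lemma char_sum_bound:
  assumes r: "0 < r"
  shows "char_sum r \<le> w 1 / r"
  unfolding char_sum_def
proof (rule suminf_le_const[OF surv_summable[OF r]])
  show "(\<Sum>k<n. surv (Suc k) r) \<le> w 1 / r" for n
    using surv_partial_sum_bound[of r n] r by (simp add: field_simps)
qed

lemma char_sum_nonneg: "0 < r \<Longrightarrow> 0 \<le> char_sum r"
  unfolding char_sum_def by (intro suminf_nonneg surv_summable less_imp_le[OF surv_pos]) auto

text \<open>All terms are antitone; strictness is read off the first one alone, where
  \<open>f 1 > 0\<close>.\<close>

lemma char_sum_strict_antimono:
  assumes "0 < r" "r < s"
  shows "char_sum s < char_sum r"
proof -
  have s: "0 < s" using assms by simp
  have "char_sum t = surv (Suc 0) t + (\<Sum>k. surv (Suc (Suc k)) t)" if "0 < t" for t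
    unfolding char_sum_def using suminf_split_head[OF surv_summable[OF that]] by simp
  moreover have "(\<Sum>k. surv (Suc (Suc k)) s) \<le> (\<Sum>k. surv (Suc (Suc k)) r)"
    using assms s surv_summable[OF s] surv_summable[OF assms(1)]
    by (intro suminf_le surv_antimono) (auto simp: summable_Suc_iff[of "\<lambda>k. surv (Suc k) _"])
  ultimately show ?thesis using surv_1_strict[OF assms] assms s by simp
qed

lemma continuous_on_surv: "continuous_on {0..} (surv k)"
  unfolding surv_def[abs_def]
  by (intro continuous_intros) (auto simp: add_nonneg_eq_0_iff f_nonneg)

text \<open>On a half-line away from 0 the terms are dominated by their values at the left end. At 0
  all terms equal 1 and the series diverges, hence \<open>a > 0\<close>.\<close>

lemma continuous_on_char_sum:
  assumes "0 < a"
  shows "continuous_on {a..} char_sum"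
proof -
  have "uniform_limit {a..} (\<lambda>n r. \<Sum>k<n. surv (Suc k) r) (\<lambda>r. \<Sum>k. surv (Suc k) r) sequentially"
  proof (rule Weierstrass_m_test[OF _ surv_summable[OF assms]])
    fix n r assume "r \<in> {a..}"
    then show "norm (surv (Suc n) r) \<le> surv (Suc n) a"
      using assms surv_pos[of r "Suc n"] surv_antimono[of a r "Suc n"] by simp
  qed
  moreover have "continuous_on {a..} (\<lambda>r. \<Sum>k<n. surv (Suc k) r)" for n
    using assms by (intro continuous_intros continuous_on_subset[OF continuous_on_surv]) auto
  ultimately show ?thesis
    unfolding char_sum_def[abs_def] by (intro uniform_limit_theorem) auto
qed

lemma ex_char_root: "\<exists>r>0. char_sum r = 1"
proof -
  \<comment> \<open>\<open>char_sum b \<le> w 1 / b\<close>, so any \<open>b\<close> above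
    \<open>w 1\<close> is a right end point for the intermediate value theorem; the 1 makes room for
    the left end point chosen below.\<close>
  define b where "b = max (w 1) 1"
  have "b \<ge> 1" "w 1 \<le> b" by (auto simp: b_def)
  then have b: "b \<ge> 1" "char_sum b \<le> 1"
    using char_sum_bound[of b] by (auto intro: order.trans)
  \<comment> \<open>Two terms suffice at the left end: each tends to 1 as \<open>r\<close> tends to
    0, so their sum exceeds 1 close to 0.\<close>
  have "((\<lambda>r. surv (Suc 0) r + surv (Suc (Suc 0)) r) \<longlongrightarrow> surv (Suc 0) 0 + surv (Suc (Suc 0)) 0) (at 0 within {0..})"
    using continuous_on_surv by (intro tendsto_intros) (auto simp: continuous_on_def)
  then have "\<forall>\<^sub>F r in at 0 within {0..}. 1 < surv (Suc 0) r + surv (Suc (Suc 0)) r"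
    by (rule order_tendstoD) (simp add: surv_def)
  then obtain d where d: "d > 0" "\<And>r. 0 < r \<Longrightarrow> r < d \<Longrightarrow> 1 < surv (Suc 0) r + surv (Suc (Suc 0)) r"
    by (auto simp: eventually_at dist_real_def)
  define a where "a = min (d / 2) 1"
  have a: "0 < a" "a < d" "a \<le> b" using d b by (auto simp: a_def)
  have "1 < (\<Sum>k<2. surv (Suc k) a)" using d(2)[OF a(1,2)] by (simp add: numeral_2_eq_2)
  also have "\<dots> \<le> char_sum a" unfolding char_sum_def
    using a by (intro sum_le_suminf surv_summable) (auto intro: less_imp_le[OF surv_pos])
  finally have "1 < char_sum a" .
  moreover have "continuous_on {a..b} char_sum"
    using continuous_on_subset[OF continuous_on_char_sum[OF a(1)], of "{a..b}"] by auto
  ultimately obtain r where "a \<le> r" "r \<le> b" "char_sum r = 1"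
    using IVT2'[of char_sum b 1 a] b a by auto
  then show ?thesis using a by (intro exI[of _ r]) auto
qed

lemma is_rate_iff: "is_rate \<alpha> \<delta> r \<longleftrightarrow> 0 < r \<and> char_sum r = 1"
proof -
  have "(\<lambda>n. \<Prod>j=1..Suc n. 1 / ((real j + \<delta>) powr \<alpha> * r + 1)) = (\<lambda>n. surv (Suc n) r)"
    by (simp only: surv_def f_def add.commute)
  then show ?thesis
    unfolding is_rate_def char_sum_def
    using summable_sums[OF surv_summable] by (auto simp: sums_iff)
qed

lemma ex1_rate: "\<exists>!r. is_rate \<alpha> \<delta> r"
  unfolding is_rate_iff
  using ex_char_root char_sum_strict_antimono by (metis less_irrefl linorder_neqE_linordered_idom)

lemma rate_pos: "0 < rate \<alpha> \<delta>" and char_sum_rate: "char_sum (rate \<alpha> \<delta>) = 1"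
  using theI'[OF ex1_rate, folded rate_def, unfolded is_rate_iff] by simp_all

text \<open>With tail proportions \<open>surv k r\<close>, the left-hand side is the total weight
  per vertex when weights are cut off at level \<open>K\<close>. By the balance equation it is a
  partial sum of \<open>r * char_sum r\<close> plus a boundary term. So weight \<open>r\<close> put
  into the tail recursion returns weight \<open>r * char_sum r\<close>, and the characteristic
  equation is the fixed-point condition.\<close>

lemma surv_abel:
  assumes "0 \<le> r" "K \<ge> 1"
  shows "w 1 - (\<Sum>k=1..<K. (w k - w (Suc k)) * surv k r)
    = r * (\<Sum>k=1..<K. surv k r) + w K * surv (K - 1) r"
  using assms(2)
proof (induction K rule: dec_induct)
  case base then show ?case by simp
next
  case (step K)
  obtain j where j: "K = Suc j" using step by (cases K) auto
  have "r * surv K r = w K * (surv (K - 1) r - surv K r)"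
    using surv_step[OF assms(1), of j] j by simp
  moreover have "(\<Sum>k=1..<Suc K. (w k - w (Suc k)) * surv k r)
      = (\<Sum>k=1..<K. (w k - w (Suc k)) * surv k r) + (w K - w (Suc K)) * surv K r"
    "r * (\<Sum>k=1..<Suc K. surv k r) = r * (\<Sum>k=1..<K. surv k r) + r * surv K r"
    using step by (simp_all add: distrib_left)
  ultimately show ?case
    using step.IH unfolding left_diff_distrib right_diff_distrib diff_Suc_1 by linarith
qed

end

section \<open>Deterministic limit of the total weight\<close>

context depref_params
begin

lemma surv_Suc_weight: "0 < r \<Longrightarrow> surv (Suc k) r = surv k r * (w (Suc k) / r) / (1 + w (Suc k) / r)"
  using f_pos[of "Suc k"] by (simp add: surv_Suc w_def divide_simps add_pos_pos)

text \<open>Induction over the levels. With \<open>c = w (Suc k) / b\<close>, a bound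
  \<open>y\<close> for the tail one level down turns the recursion into a drift
  \<open>c * y - c * x n / n\<close>, whose equilibrium \<open>c * y / (1 + c)\<close> is
  \<open>surv (Suc k) b\<close> when \<open>y = surv k b\<close>.\<close>

lemma tail_lower_bound:
  fixes T :: "nat \<Rightarrow> nat \<Rightarrow> real" and S :: "nat \<Rightarrow> real" and \<xi> :: "nat \<Rightarrow> nat \<Rightarrow> real"
  assumes T1: "\<And>n. T 1 n = real n"
    and anti: "\<And>k n. k \<ge> 1 \<Longrightarrow> T (Suc k) n \<le> T k n"
    and Spos: "\<And>n. n \<ge> 1 \<Longrightarrow> 0 < S n"
    and rec: "\<And>k n. k \<ge> 1 \<Longrightarrow> n \<ge> 1 \<Longrightarrow>
      T (Suc k) (Suc n) = T (Suc k) n + w k * (T k n - T (Suc k) n) / S n + \<xi> k n"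
    and noise: "\<And>k. k \<ge> 1 \<Longrightarrow> (\<lambda>n. (\<Sum>m<n. \<xi> k m) / real n) \<longlonglongrightarrow> 0"
    and b: "0 < b" and Sb: "\<forall>\<^sub>F n in sequentially. S n \<le> b * real n"
    and q: "q < surv k b"
  shows "\<forall>\<^sub>F n in sequentially. q < T (Suc k) n / real n"
  using q
proof (induction k arbitrary: q)
  case 0
  show ?case using eventually_gt_at_top[of 0]
    by eventually_elim (use 0 T1 in simp)
next
  case (Suc k)
  define c where "c = w (Suc k) / b"
  have c: "c > 0" using w_pos[of "Suc k"] b by (simp add: c_def)
  \<comment> \<open>This leaves room for a \<open>y\<close> strictly below \<open>surv k b\<close>,
    as the induction hypothesis demands, whose equilibrium is still strictly above
    \<open>q\<close>.\<close>
  have "q * (1 + c) / c < surv k b"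
    using Suc.prems c surv_Suc_weight[OF b, of k] by (simp add: c_def[symmetric] field_simps)
  then obtain y where "q * (1 + c) / c < y" "y < surv k b" using dense by blast
  then have y: "y < surv k b" "q < (c * y) / (1 + c)" using c by (simp_all add: field_simps)
  show ?case
  proof (rule drift_lower_bound[OF less_imp_le[OF c] noise[of "Suc k"] _ y(2)])
    show "\<forall>\<^sub>F n in sequentially. T (Suc (Suc k)) n + c * y - c * T (Suc (Suc k)) n / real n + \<xi> (Suc k) n
            \<le> T (Suc (Suc k)) (Suc n)"
      using Suc.IH[OF y(1)] Sb eventually_gt_at_top[of 0]
    proof eventually_elim
      case (elim n)
      have n: "real n > 0" and S: "S n > 0" using elim Spos[of n] by auto
      have d: "T (Suc k) n - T (Suc (Suc k)) n \<ge> 0" using anti[of "Suc k" n] by simp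
      have "y * real n \<le> T (Suc k) n" using elim(1) n by (simp add: field_simps)
      then have "c * (y * real n - T (Suc (Suc k)) n) / real n
          \<le> c * (T (Suc k) n - T (Suc (Suc k)) n) / real n"
        using c n by (intro divide_right_mono mult_left_mono) auto
      also have "\<dots> = w (Suc k) * (T (Suc k) n - T (Suc (Suc k)) n) / (b * real n)" by (simp add: c_def)
      also have "\<dots> \<le> w (Suc k) * (T (Suc k) n - T (Suc (Suc k)) n) / S n"
        using elim S b n d w_nonneg[of "Suc k"] by (intro divide_left_mono mult_nonneg_nonneg mult_pos_pos)
      finally have "c * (y * real n - T (Suc (Suc k)) n) / real n
          \<le> w (Suc k) * (T (Suc k) n - T (Suc (Suc k)) n) / S n" .
      moreover have "c * (y * real n - T (Suc (Suc k)) n) / real n = c * y - c * T (Suc (Suc k)) n / real n"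
        using n by (simp add: field_simps)
      ultimately show ?case using rec[of "Suc k" n] elim by simp
    qed
  qed simp
qed

text \<open>The mirror image of the lower bound: the drift lemma is applied to the negated tails and
  the negated noise. Here positivity of \<open>S n\<close> comes from the bound
  \<open>a * n\<close>.\<close>

lemma tail_upper_bound:
  fixes T :: "nat \<Rightarrow> nat \<Rightarrow> real" and S :: "nat \<Rightarrow> real" and \<xi> :: "nat \<Rightarrow> nat \<Rightarrow> real"
  assumes T1: "\<And>n. T 1 n = real n"
    and anti: "\<And>k n. k \<ge> 1 \<Longrightarrow> T (Suc k) n \<le> T k n"
    and rec: "\<And>k n. k \<ge> 1 \<Longrightarrow> n \<ge> 1 \<Longrightarrow>
      T (Suc k) (Suc n) = T (Suc k) n + w k * (T k n - T (Suc k) n) / S n + \<xi> k n"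
    and noise: "\<And>k. k \<ge> 1 \<Longrightarrow> (\<lambda>n. (\<Sum>m<n. \<xi> k m) / real n) \<longlonglongrightarrow> 0"
    and a: "0 < a" and Sa: "\<forall>\<^sub>F n in sequentially. a * real n \<le> S n"
    and q: "surv k a < q"
  shows "\<forall>\<^sub>F n in sequentially. T (Suc k) n / real n < q"
  using q
proof (induction k arbitrary: q)
  case 0
  show ?case using eventually_gt_at_top[of 0]
    by eventually_elim (use 0 T1 in simp)
next
  case (Suc k)
  define c where "c = w (Suc k) / a"
  have c: "c > 0" using w_pos[of "Suc k"] a by (simp add: c_def)
  have "q * (1 + c) / c > surv k a"
    using Suc.prems c surv_Suc_weight[OF a, of k] by (simp add: c_def[symmetric] field_simps)
  then obtain y where "surv k a < y" "y < q * (1 + c) / c" using dense by blast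
  then have y: "surv k a < y" "- q < (- (c * y)) / (1 + c)" using c by (simp_all add: field_simps)
  have "(\<lambda>n. (\<Sum>m<n. - \<xi> (Suc k) m) / real n) \<longlonglongrightarrow> 0"
    using tendsto_minus[OF noise[of "Suc k"]] by (simp add: sum_negf)
  then have "\<forall>\<^sub>F n in sequentially. - q < (\<lambda>n. - T (Suc (Suc k)) n) n / real n"
  proof (rule drift_lower_bound[OF less_imp_le[OF c] _ _ y(2)])
    show "\<forall>\<^sub>F n in sequentially. - T (Suc (Suc k)) n + - (c * y) - c * - T (Suc (Suc k)) n / real n
            + - \<xi> (Suc k) n \<le> - T (Suc (Suc k)) (Suc n)"
      using Suc.IH[OF y(1)] Sa eventually_gt_at_top[of 0]
    proof eventually_elim
      case (elim n)
      have n: "real n > 0" using elim by auto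
      have an: "0 < a * real n" using a n by simp
      have S: "S n > 0" using elim(2) an by linarith
      have d: "T (Suc k) n - T (Suc (Suc k)) n \<ge> 0" using anti[of "Suc k" n] by simp
      have yn: "T (Suc k) n \<le> y * real n" using elim(1) n by (simp add: field_simps)
      have "w (Suc k) * (T (Suc k) n - T (Suc (Suc k)) n) / S n
          \<le> w (Suc k) * (T (Suc k) n - T (Suc (Suc k)) n) / (a * real n)"
        using elim S a n d w_nonneg[of "Suc k"] by (intro divide_left_mono mult_nonneg_nonneg mult_pos_pos)
      also have "\<dots> = c * (T (Suc k) n - T (Suc (Suc k)) n) / real n" by (simp add: c_def)
      also have "\<dots> \<le> c * (y * real n - T (Suc (Suc k)) n) / real n"
        using c n yn by (intro divide_right_mono mult_left_mono) auto
      also have "\<dots> = c * y - c * T (Suc (Suc k)) n / real n"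
        using n by (simp add: field_simps)
      finally show ?case using rec[of "Suc k" n] elim by simp
    qed
  qed
  then show ?case by simp
qed

text \<open>A purely deterministic statement, to be applied to almost every path. The two
  inequalities \<open>S_le\<close> and \<open>S_ge\<close> express \<open>S\<close> by finitely many
  tails up to the truncation error \<open>w K * n\<close>.\<close>

lemma weight_and_tail_limit:
  fixes T :: "nat \<Rightarrow> nat \<Rightarrow> real" and S :: "nat \<Rightarrow> real" and \<xi> :: "nat \<Rightarrow> nat \<Rightarrow> real"
  assumes T1: "\<And>n. T 1 n = real n"
    and anti: "\<And>k n. k \<ge> 1 \<Longrightarrow> T (Suc k) n \<le> T k n"
    and Spos: "\<And>n. n \<ge> 1 \<Longrightarrow> 0 < S n"
    and rec: "\<And>k n. k \<ge> 1 \<Longrightarrow> n \<ge> 1 \<Longrightarrow>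
      T (Suc k) (Suc n) = T (Suc k) n + w k * (T k n - T (Suc k) n) / S n + \<xi> k n"
    and noise: "\<And>k. k \<ge> 1 \<Longrightarrow> (\<lambda>n. (\<Sum>m<n. \<xi> k m) / real n) \<longlonglongrightarrow> 0"
    and S_le: "\<And>K n. K \<ge> 1 \<Longrightarrow>
      S n \<le> w 1 * real n - (\<Sum>k=1..<K. (w k - w (Suc k)) * T (Suc k) n)"
    and S_ge: "\<And>K n. K \<ge> 1 \<Longrightarrow>
      w 1 * real n - (\<Sum>k=1..<K. (w k - w (Suc k)) * T (Suc k) n) \<le> S n + w K * real n"
    and S_lin: "0 < c0" "\<And>n. c0 * real n \<le> S n"
  shows "(\<lambda>n. S n / real n) \<longlonglongrightarrow> rate \<alpha> \<delta>"
    and "(\<lambda>n. T (Suc k) n / real n) \<longlonglongrightarrow> surv k (rate \<alpha> \<delta>)"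
proof -
  have low: "\<forall>\<^sub>F n in sequentially. q < T (Suc k) n / real n"
    if "0 < b" "\<forall>\<^sub>F n in sequentially. S n \<le> b * real n" "q < surv k b" for b q k
    using T1 anti Spos rec noise that by (rule tail_lower_bound)
  have upp: "\<forall>\<^sub>F n in sequentially. T (Suc k) n / real n < q"
    if "0 < a" "\<forall>\<^sub>F n in sequentially. a * real n \<le> S n" "surv k a < q" for a q k
    using T1 anti rec noise that by (rule tail_upper_bound)
  let ?l = "rate \<alpha> \<delta>"
  have dw: "w k - w (Suc k) \<ge> 0" if "k \<ge> 1" for k using w_antimono[of k "Suc k"] that by simp
  have dw_sum: "(\<Sum>k=1..<K. w k - w (Suc k)) \<le> w 1" if "K \<ge> 1" for K
    using sum_Suc_diff'[of 1 K w] that w_nonneg[of K]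
    by (simp add: sum_subtractf)
  \<comment> \<open>One round of the bootstrap: an upper rate \<open>b\<close> for the weight may be
    replaced by any number above \<open>b * char_sum b\<close>. This improves \<open>b\<close>
    exactly when \<open>char_sum b < 1\<close>, that is above the rate.\<close>
  have up_step: "\<forall>\<^sub>F n in sequentially. S n \<le> c * real n"
    if b: "0 < b" "\<forall>\<^sub>F n in sequentially. S n \<le> b * real n" and c: "b * char_sum b < c" for b c
  proof -
    define \<eta> where "\<eta> = (c - b * char_sum b) / 2"
    have \<eta>: "\<eta> > 0" using c by (simp add: \<eta>_def)
    have "\<forall>\<^sub>F K in sequentially. w K < \<eta>" using order_tendstoD(2)[OF w_tendsto_0 \<eta>] .
    then obtain K0 where "\<And>K. K \<ge> K0 \<Longrightarrow> w K < \<eta>" by (auto simp: eventually_sequentially)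
    then obtain K where K: "K \<ge> 1" "w K < \<eta>" by (meson nle_le)
    \<comment> \<open>The error allowed for each tail. The coefficients
      \<open>w k - w (Suc k)\<close> have sum at most \<open>w 1\<close>, so all tails together cost
      at most \<open>\<eta>\<close>, however large \<open>K\<close> is.\<close>
    define \<theta> where "\<theta> = \<eta> / (w 1 + 1)"
    have \<theta>: "\<theta> > 0" "\<theta> * w 1 \<le> \<eta>" using \<eta> w_nonneg[of 1] by (auto simp: \<theta>_def field_simps add_nonneg_pos)
    have "\<forall>\<^sub>F n in sequentially. \<forall>k\<in>{1..<K}. surv k b - \<theta> < T (Suc k) n / real n"
      using \<theta> by (intro eventually_ball_finite ballI low[OF b]) auto
    then show ?thesis using eventually_gt_at_top[of 0]
    proof eventually_elim
      case (elim n)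
      have n: "real n > 0" using elim by simp
      have "(\<Sum>k=1..<K. (w k - w (Suc k)) * surv k b) - \<theta> * (\<Sum>k=1..<K. w k - w (Suc k))
          = (\<Sum>k=1..<K. (w k - w (Suc k)) * (surv k b - \<theta>))"
        by (simp add: sum_distrib_left sum_subtractf[symmetric] algebra_simps)
      also have "\<dots> \<le> (\<Sum>k=1..<K. (w k - w (Suc k)) * (T (Suc k) n / real n))"
        using elim(1) dw by (intro sum_mono mult_left_mono) (auto intro: less_imp_le)
      also have "\<dots> = (\<Sum>k=1..<K. (w k - w (Suc k)) * T (Suc k) n) / real n"
        by (simp add: sum_divide_distrib)
      finally have 1: "(\<Sum>k=1..<K. (w k - w (Suc k)) * surv k b) - \<theta> * (\<Sum>k=1..<K. w k - w (Suc k))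
         \<le> (\<Sum>k=1..<K. (w k - w (Suc k)) * T (Suc k) n) / real n" .
      have 2: "\<theta> * (\<Sum>k=1..<K. w k - w (Suc k)) \<le> \<eta>"
        using mult_left_mono[OF dw_sum[OF K(1)], of \<theta>] \<theta> by linarith
      have "S n / real n \<le> (w 1 * real n - (\<Sum>k=1..<K. (w k - w (Suc k)) * T (Suc k) n)) / real n"
        using S_le[OF K(1), of n] n by (intro divide_right_mono) auto
      also have "\<dots> = w 1 - (\<Sum>k=1..<K. (w k - w (Suc k)) * T (Suc k) n) / real n"
        using n by (simp add: diff_divide_distrib)
      also have "\<dots> \<le> w 1 - (\<Sum>k=1..<K. (w k - w (Suc k)) * surv k b) + \<eta>" using 1 2 by linarith
      also have "\<dots> = b * (\<Sum>k=1..<K. surv k b) + w K * surv (K - 1) b + \<eta>"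
        using surv_abel[of b K] b K by simp
      also have "w K * surv (K - 1) b \<le> w K * 1"
        using b by (intro mult_left_mono surv_le_1 w_nonneg) auto
      also have "(\<Sum>k=1..<K. surv k b) = (\<Sum>k<K-1. surv (Suc k) b)"
        using K sum.shift_bounds_Suc_ivl[of "\<lambda>k. surv k b" 0 "K - 1"] by (simp add: lessThan_atLeast0)
      also have "\<dots> \<le> char_sum b"
        unfolding char_sum_def using b
        by (intro sum_le_suminf surv_summable) (auto intro: less_imp_le[OF surv_pos])
      finally have "S n / real n \<le> b * char_sum b + w K * 1 + \<eta>" using b by simp
      also have "\<dots> \<le> c" using K(2) unfolding \<eta>_def by (simp add: field_simps)
      finally show ?case using n by (simp add: field_simps)
    qed
  qed
  have lo_step: "\<forall>\<^sub>F n in sequentially. c * real n \<le> S n"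
    if a: "0 < a" "\<forall>\<^sub>F n in sequentially. a * real n \<le> S n" and c: "c < a * char_sum a" for a c
  proof -
    \<comment> \<open>A third of the gap for each of three losses: the cut-off of the series, the
      boundary weight \<open>w K\<close>, and the errors of the tails.\<close>
    define \<eta> where "\<eta> = (a * char_sum a - c) / 3"
    have \<eta>: "\<eta> > 0" using c by (simp add: \<eta>_def)
    have evw: "\<forall>\<^sub>F K in sequentially. w (Suc K) < \<eta>"
      using order_tendstoD(2)[OF LIMSEQ_Suc[OF w_tendsto_0] \<eta>] .
    have "(\<lambda>K. a * (\<Sum>k<K. surv (Suc k) a)) \<longlonglongrightarrow> a * char_sum a"
      unfolding char_sum_def by (intro tendsto_intros summable_LIMSEQ surv_summable a)
    then have "\<forall>\<^sub>F K in sequentially. a * char_sum a - \<eta> < a * (\<Sum>k<K. surv (Suc k) a)"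
      by (rule order_tendstoD) (use \<eta> in simp)
    then have "\<forall>\<^sub>F K in sequentially. w (Suc K) < \<eta> \<and> a * char_sum a - \<eta> < a * (\<Sum>k<K. surv (Suc k) a)"
      using evw by (rule eventually_elim2) simp
    then obtain J where J: "w (Suc J) < \<eta>" "a * char_sum a - \<eta> < a * (\<Sum>k<J. surv (Suc k) a)"
      using eventually_happens'[OF sequentially_bot] by blast
    define K where "K = Suc J"
    have K: "K \<ge> 1" by (simp add: K_def)
    define \<theta> where "\<theta> = \<eta> / (w 1 + 1)"
    have \<theta>: "\<theta> > 0" "\<theta> * w 1 \<le> \<eta>" using \<eta> w_nonneg[of 1] by (auto simp: \<theta>_def field_simps add_nonneg_pos)
    have "\<forall>\<^sub>F n in sequentially. \<forall>k\<in>{1..<K}. T (Suc k) n / real n < surv k a + \<theta>"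
      using \<theta> by (intro eventually_ball_finite ballI upp[OF a]) auto
    then show ?thesis using eventually_gt_at_top[of 0]
    proof eventually_elim
      case (elim n)
      have n: "real n > 0" using elim by simp
      have "(\<Sum>k=1..<K. (w k - w (Suc k)) * T (Suc k) n) / real n
          = (\<Sum>k=1..<K. (w k - w (Suc k)) * (T (Suc k) n / real n))"
        by (simp add: sum_divide_distrib)
      also have "\<dots> \<le> (\<Sum>k=1..<K. (w k - w (Suc k)) * (surv k a + \<theta>))"
        using elim(1) dw by (intro sum_mono mult_left_mono) (auto intro: less_imp_le)
      also have "\<dots> = (\<Sum>k=1..<K. (w k - w (Suc k)) * surv k a) + \<theta> * (\<Sum>k=1..<K. w k - w (Suc k))"
        by (simp add: sum_distrib_left sum.distrib[symmetric] algebra_simps)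
      finally have 1: "(\<Sum>k=1..<K. (w k - w (Suc k)) * T (Suc k) n) / real n
         \<le> (\<Sum>k=1..<K. (w k - w (Suc k)) * surv k a) + \<theta> * (\<Sum>k=1..<K. w k - w (Suc k))" .
      have 2: "\<theta> * (\<Sum>k=1..<K. w k - w (Suc k)) \<le> \<eta>"
        using mult_left_mono[OF dw_sum[OF K(1)], of \<theta>] \<theta> by linarith
      have sh: "(\<Sum>k=1..<K. surv k a) = (\<Sum>k<J. surv (Suc k) a)"
        using sum.shift_bounds_Suc_ivl[of "\<lambda>k. surv k a" 0 J] by (simp add: lessThan_atLeast0 K_def)
      have "c < a * (\<Sum>k<J. surv (Suc k) a) - 2 * \<eta>" using J(2) unfolding \<eta>_def by (simp add: field_simps)
      also have "\<dots> \<le> a * (\<Sum>k=1..<K. surv k a) + w K * surv (K - 1) a - w K - \<eta>"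
      proof -
        have "0 \<le> w K * surv (K - 1) a"
          using a by (intro mult_nonneg_nonneg w_nonneg less_imp_le[OF surv_pos]) simp
        moreover have "w K < \<eta>" using J(1) by (simp add: K_def)
        ultimately show ?thesis unfolding sh by linarith
      qed
      also have "\<dots> = w 1 - (\<Sum>k=1..<K. (w k - w (Suc k)) * surv k a) - \<eta> - w K"
        using surv_abel[of a K] a K by simp
      also have "\<dots> \<le> w 1 - (\<Sum>k=1..<K. (w k - w (Suc k)) * T (Suc k) n) / real n - w K"
        using 1 2 by linarith
      also have "\<dots> = (w 1 * real n - (\<Sum>k=1..<K. (w k - w (Suc k)) * T (Suc k) n) - w K * real n) / real n"
        using n by (simp add: diff_divide_distrib)
      also have "\<dots> \<le> S n / real n"
        using S_ge[OF K(1), of n] n by (intro divide_right_mono) auto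
      finally show ?case using n by (simp add: field_simps)
    qed
  qed
  have up: "\<forall>\<^sub>F n in sequentially. S n \<le> b * real n" if "?l < b" for b
  proof -
    define B where "B = {b. 0 < b \<and> (\<forall>\<^sub>F n in sequentially. S n \<le> b * real n)}"
    have Bup: "c \<in> B" if "b \<in> B" "b \<le> c" for b c
    proof -
      have "\<forall>\<^sub>F n in sequentially. S n \<le> b * real n" using that by (simp add: B_def)
      then have "\<forall>\<^sub>F n in sequentially. S n \<le> c * real n"
        by eventually_elim (use that in \<open>meson mult_right_mono of_nat_0_le_iff order.trans\<close>)
      then show ?thesis using that by (auto simp: B_def)
    qed
    \<comment> \<open>For \<open>K = 1\<close> the sum in \<open>S_le\<close> is empty, which gives
      a first upper rate.\<close>
    have "w 1 \<in> B" using S_le[of 1] w_pos[of 1] by (simp add: B_def)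
    then have ne: "B \<noteq> {}" by auto
    have bdd: "bdd_below B" by (rule bdd_belowI[of _ 0]) (auto simp: B_def)
    have "Inf B \<le> ?l"
    proof (rule ccontr)
      assume "\<not> ?thesis"
      then have l: "?l < Inf B" by simp
      then have F1: "char_sum (Inf B) < 1"
        using char_sum_strict_antimono[OF rate_pos] char_sum_rate by fastforce
      have I0: "Inf B > 0" using l rate_pos by simp
      have F0: "char_sum (Inf B) \<ge> 0" using char_sum_nonneg[OF I0] .
      \<comment> \<open>A factor strictly between \<open>char_sum (Inf B)\<close> and 1. An element
        \<open>b\<close> of \<open>B\<close> close enough to \<open>Inf B\<close> is improved to
        \<open>b * s < Inf B\<close>; monotonicity of \<open>char_sum\<close> replaces continuity at
        the infimum.\<close>
      define s where "s = (1 + char_sum (Inf B)) / 2"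
      have s: "0 < s" "s < 1" "char_sum (Inf B) < s" using F0 F1 by (auto simp: s_def)
      have "Inf B < Inf B / s" using s I0 by (simp add: field_simps)
      then obtain b where b: "b \<in> B" "b < Inf B / s" using cInf_lessD[OF ne] by blast
      have b0: "0 < b" "Inf B \<le> b" using b cInf_lower[OF b(1) bdd] by (auto simp: B_def)
      have "char_sum b \<le> char_sum (Inf B)"
        using char_sum_strict_antimono[OF I0, of b] b0 by (cases "b = Inf B") auto
      then have "b * char_sum b \<le> b * char_sum (Inf B)" using b0 by (intro mult_left_mono) auto
      also have "\<dots> < b * s" using s b0 by (intro mult_strict_left_mono) auto
      finally have "b * char_sum b < b * s" .
      then have "b * s \<in> B" using up_step[OF b0(1) _ , of "b * s"] b(1) s b0 by (auto simp: B_def)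
      then have "Inf B \<le> b * s" using bdd by (intro cInf_lower)
      then show False using b(2) s by (simp add: field_simps)
    qed
    then have "Inf B < b" using that by simp
    then obtain b' where "b' \<in> B" "b' < b" using cInf_lessD[OF ne] by blast
    then show ?thesis using Bup[of b' b] by (simp add: B_def)
  qed
  have lo: "\<forall>\<^sub>F n in sequentially. a * real n \<le> S n" if "a < ?l" for a
  proof -
    define A where "A = {a. 0 < a \<and> (\<forall>\<^sub>F n in sequentially. a * real n \<le> S n)}"
    have Adown: "\<forall>\<^sub>F n in sequentially. c * real n \<le> S n" if "a \<in> A" "c \<le> a" for a c
    proof -
      have "\<forall>\<^sub>F n in sequentially. a * real n \<le> S n" using that by (simp add: A_def)
      then show "\<forall>\<^sub>F n in sequentially. c * real n \<le> S n"
        by eventually_elim (use that in \<open>meson mult_right_mono of_nat_0_le_iff order.trans\<close>)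
    qed
    \<comment> \<open>The linear lower bound puts a positive number into \<open>A\<close>, so that
      \<open>Sup A\<close> is positive and the results on \<open>char_sum\<close> apply to
      it.\<close>
    have c0A: "c0 \<in> A" using S_lin by (simp add: A_def)
    then have ne: "A \<noteq> {}" by auto
    have bdd: "bdd_above A"
    proof (rule bdd_aboveI[of _ "w 1"])
      fix a assume "a \<in> A"
      then have "\<forall>\<^sub>F n in sequentially. a * real n \<le> S n" by (simp add: A_def)
      then have "\<forall>\<^sub>F n in sequentially. a * real n \<le> S n \<and> 0 < n"
        using eventually_gt_at_top[of 0] by (rule eventually_conj)
      then obtain n where n: "a * real n \<le> S n" "0 < n"
        using eventually_happens'[OF sequentially_bot] by blast
      have "S n \<le> w 1 * real n" using S_le[of 1 n] by simp
      then have "a * real n \<le> w 1 * real n" using n(1) by linarith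
      then show "a \<le> w 1" using n by simp
    qed
    have "?l \<le> Sup A"
    proof (rule ccontr)
      assume "\<not> ?thesis"
      then have l: "Sup A < ?l" by simp
      have I0: "Sup A > 0" using cSup_upper[OF c0A bdd] S_lin(1) by simp
      then have F1: "char_sum (Sup A) > 1"
        using char_sum_strict_antimono[OF I0 l] char_sum_rate by simp
      define s where "s = (1 + char_sum (Sup A)) / 2"
      have s: "1 < s" "s < char_sum (Sup A)" using F1 by (auto simp: s_def)
      have "Sup A / s < Sup A" using s I0 by (simp add: field_simps)
      then obtain a where a: "a \<in> A" "Sup A / s < a" using less_cSupD[OF ne] by blast
      have a0: "0 < a" "a \<le> Sup A" using a cSup_upper[OF a(1) bdd] by (auto simp: A_def)
      have "a * s < a * char_sum (Sup A)" using s a0 by (intro mult_strict_left_mono) auto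
      also have "char_sum (Sup A) \<le> char_sum a"
        using char_sum_strict_antimono[OF a0(1), of "Sup A"] a0 by (cases "a = Sup A") auto
      finally have "a * s < a * char_sum a" using a0 by simp
      then have "a * s \<in> A" using lo_step[OF a0(1) _ , of "a * s"] a(1) s a0 by (auto simp: A_def)
      then have "a * s \<le> Sup A" using bdd by (intro cSup_upper)
      then show False using a(2) s by (simp add: field_simps)
    qed
    then have "a < Sup A" using that by simp
    then obtain a' where "a' \<in> A" "a < a'" using less_cSupD[OF ne] by blast
    then show ?thesis using Adown[of a' a] by simp
  qed
  show "(\<lambda>n. S n / real n) \<longlonglongrightarrow> ?l"
  proof (rule order_tendstoI)
    fix a assume "a < ?l"
    then obtain a' where a': "a < a'" "a' < ?l" using dense by blast
    show "\<forall>\<^sub>F n in sequentially. a < S n / real n"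
      using lo[OF a'(2)] eventually_gt_at_top[of 0]
    proof eventually_elim
      case (elim n)
      then have "a' \<le> S n / real n" by (simp add: field_simps)
      then show ?case using a' by simp
    qed
  next
    fix a assume "?l < a"
    then obtain a' where a': "a' < a" "?l < a'" using dense by blast
    show "\<forall>\<^sub>F n in sequentially. S n / real n < a"
      using up[OF a'(2)] eventually_gt_at_top[of 0]
    proof eventually_elim
      case (elim n)
      then have "S n / real n \<le> a'" by (simp add: field_simps)
      then show ?case using a' by simp
    qed
  qed
  \<comment> \<open>The one-sided tail bounds hold at every rate slightly above or below the limit;
    continuity of \<open>surv k\<close> lets the perturbation disappear.\<close>
  have cont: "isCont (surv k) ?l"
    using continuous_on_interior[OF continuous_on_surv, of ?l] rate_pos by (simp add: interior_real_atLeast)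
  show "(\<lambda>n. T (Suc k) n / real n) \<longlonglongrightarrow> surv k ?l"
  proof (rule order_tendstoI)
    fix q assume "q < surv k ?l"
    then have "\<forall>\<^sub>F r in at ?l. q < surv k r" using cont by (auto simp: isCont_def intro: order_tendstoD)
    then obtain d where d: "d > 0" "\<And>r. r \<noteq> ?l \<Longrightarrow> dist r ?l < d \<Longrightarrow> q < surv k r"
      by (auto simp: eventually_at)
    have "q < surv k (?l + d / 2)" using d by (intro d(2)) (auto simp: dist_real_def)
    then show "\<forall>\<^sub>F n in sequentially. q < T (Suc k) n / real n"
      using d rate_pos by (intro low[of "?l + d / 2"] up) auto
  next
    fix q assume "q > surv k ?l"
    then have "\<forall>\<^sub>F r in at ?l. q > surv k r" using cont by (auto simp: isCont_def intro: order_tendstoD)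
    then obtain d where d: "d > 0" "\<And>r. r \<noteq> ?l \<Longrightarrow> dist r ?l < d \<Longrightarrow> q > surv k r"
      by (auto simp: eventually_at)
    define e where "e = min (d / 2) (?l / 2)"
    have e: "e > 0" "e < d" "e < ?l" using d rate_pos by (auto simp: e_def)
    have "q > surv k (?l - e)" using e by (intro d(2)) (auto simp: dist_real_def)
    then show "\<forall>\<^sub>F n in sequentially. q > T (Suc k) n / real n"
      using e rate_pos by (intro upp[of "?l - e"] lo) auto
  qed
qed

end

section \<open>Bounded martingale differences\<close>

text \<open>The sum of the squares has finite expectation, hence is finite almost everywhere, and
  the terms of a convergent series vanish.\<close>

lemma (in prob_space) AE_tendsto_0_of_summable_second_moments:
  fixes X :: "nat \<Rightarrow> 'a \<Rightarrow> real"
  assumes int: "\<And>m. integrable M (\<lambda>\<omega>. (X m \<omega>)\<^sup>2)"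
    and sum: "summable (\<lambda>m. expectation (\<lambda>\<omega>. (X m \<omega>)\<^sup>2))"
  shows "AE \<omega> in M. (\<lambda>m. X m \<omega>) \<longlonglongrightarrow> 0"
proof -
  have [measurable]: "(\<lambda>\<omega>. (X m \<omega>)\<^sup>2) \<in> borel_measurable M" for m using int by auto
  have "(\<integral>\<^sup>+\<omega>. (\<Sum>m. ennreal ((X m \<omega>)\<^sup>2)) \<partial>M) = (\<Sum>m. \<integral>\<^sup>+\<omega>. ennreal ((X m \<omega>)\<^sup>2) \<partial>M)"
    by (intro nn_integral_suminf) measurable
  also have "\<dots> = (\<Sum>m. ennreal (expectation (\<lambda>\<omega>. (X m \<omega>)\<^sup>2)))"
    using int by (simp add: nn_integral_eq_integral)
  also have "\<dots> \<noteq> \<infinity>"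
    using sum by (simp add: suminf_ennreal_eq[OF _ summable_sums] integral_nonneg_AE)
  finally have "AE \<omega> in M. (\<Sum>m. ennreal ((X m \<omega>)\<^sup>2)) \<noteq> \<infinity>"
    by (intro nn_integral_PInf_AE) auto
  then show ?thesis
  proof eventually_elim
    case (elim \<omega>)
    then have "summable (\<lambda>m. (X m \<omega>)\<^sup>2)" by (intro summable_suminf_not_top) auto
    then have "(\<lambda>m. (X m \<omega>)\<^sup>2) \<longlonglongrightarrow> 0" by (rule summable_LIMSEQ_zero)
    then show ?case using tendsto_real_sqrt by (fastforce simp: tendsto_rabs_zero_iff)
  qed
qed

text \<open>Martingale differences, phrased by orthogonality to all bounded functions of the past.
  This is the form in which partial sums enter the second moment. The bound may depend on
  \<open>n\<close>, because the noise of a fixed vertex is not uniformly bounded.\<close>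

locale bounded_noise = prob_space M for M :: "'a measure" +
  fixes F :: "nat \<Rightarrow> 'a measure" and X :: "nat \<Rightarrow> 'a \<Rightarrow> real" and B :: "nat \<Rightarrow> real"
  assumes subalg: "subalgebra M (F n)"
    and filtration: "m \<le> n \<Longrightarrow> subalgebra (F n) (F m)"
    and adapted: "X n \<in> borel_measurable (F (Suc n))"
    and bounded: "\<omega> \<in> space M \<Longrightarrow> \<bar>X n \<omega>\<bar> \<le> B n"
    and orthogonal: "Z \<in> borel_measurable (F n) \<Longrightarrow> (\<And>\<omega>. \<omega> \<in> space M \<Longrightarrow> \<bar>Z \<omega>\<bar> \<le> C) \<Longrightarrow>
      expectation (\<lambda>\<omega>. Z \<omega> * X n \<omega>) = 0"
begin

lemma partial_sum_adapted: "(\<lambda>\<omega>. \<Sum>m<n. X m \<omega>) \<in> borel_measurable (F n)"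
  by (intro borel_measurable_sum measurable_from_subalg[OF filtration adapted]) simp

lemma partial_sum_measurable [measurable]: "(\<lambda>\<omega>. \<Sum>m<n. X m \<omega>) \<in> borel_measurable M"
  by (rule measurable_from_subalg[OF subalg partial_sum_adapted])

lemma measurable_X [measurable]: "X n \<in> borel_measurable M"
  by (rule measurable_from_subalg[OF subalg adapted])

lemma partial_sum_bounded: "\<omega> \<in> space M \<Longrightarrow> \<bar>\<Sum>m<n. X m \<omega>\<bar> \<le> (\<Sum>m<n. B m)"
  by (rule order.trans[OF sum_abs]) (intro sum_mono bounded)

lemma integrable_partial_sum_square: "integrable M (\<lambda>\<omega>. (\<Sum>m<n. X m \<omega>)\<^sup>2)"
proof (rule integrable_const_bound[where B = "(\<Sum>m<n. B m)\<^sup>2"])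
  show "AE \<omega> in M. norm ((\<Sum>m<n. X m \<omega>)\<^sup>2) \<le> (\<Sum>m<n. B m)\<^sup>2"
    using partial_sum_bounded by (intro AE_I2) (auto simp: abs_le_square_iff[symmetric] intro: order.trans[OF _ abs_ge_self])
qed measurable

lemma integrable_square: "integrable M (\<lambda>\<omega>. (X n \<omega>)\<^sup>2)"
proof (rule integrable_const_bound[where B = "(B n)\<^sup>2"])
  show "AE \<omega> in M. norm ((X n \<omega>)\<^sup>2) \<le> (B n)\<^sup>2"
    using bounded by (intro AE_I2) (auto simp: abs_le_square_iff[symmetric] intro: order.trans[OF _ abs_ge_self])
qed measurable

lemma second_moment:
  "expectation (\<lambda>\<omega>. (\<Sum>m<n. X m \<omega>)\<^sup>2) = (\<Sum>m<n. expectation (\<lambda>\<omega>. (X m \<omega>)\<^sup>2))"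
proof (induction n)
  case 0 then show ?case by simp
next
  case (Suc n)
  let ?Y = "\<lambda>\<omega>. \<Sum>m<n. X m \<omega>"
  have YX: "integrable M (\<lambda>\<omega>. ?Y \<omega> * X n \<omega>)"
  proof (rule integrable_const_bound[where B = "(\<Sum>m<n. B m) * B n"])
    show "AE \<omega> in M. norm (?Y \<omega> * X n \<omega>) \<le> (\<Sum>m<n. B m) * B n"
    proof (intro AE_I2)
      fix \<omega> assume w: "\<omega> \<in> space M"
      have "norm (?Y \<omega> * X n \<omega>) = \<bar>?Y \<omega>\<bar> * \<bar>X n \<omega>\<bar>" by (simp add: abs_mult)
      also have "\<dots> \<le> (\<Sum>m<n. B m) * B n"
        using partial_sum_bounded[OF w, of n] bounded[OF w, of n] by (intro mult_mono) auto
      finally show "norm (?Y \<omega> * X n \<omega>) \<le> (\<Sum>m<n. B m) * B n" .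
    qed
  qed measurable
  have "expectation (\<lambda>\<omega>. (\<Sum>m<Suc n. X m \<omega>)\<^sup>2)
      = expectation (\<lambda>\<omega>. ((?Y \<omega>)\<^sup>2 + 2 * (?Y \<omega> * X n \<omega>)) + (X n \<omega>)\<^sup>2)"
    by (simp add: power2_eq_square algebra_simps)
  also have "\<dots> = expectation (\<lambda>\<omega>. (?Y \<omega>)\<^sup>2) + 2 * expectation (\<lambda>\<omega>. ?Y \<omega> * X n \<omega>)
      + expectation (\<lambda>\<omega>. (X n \<omega>)\<^sup>2)"
    using YX integrable_partial_sum_square[of n] integrable_square[of n]
    by (subst Bochner_Integration.integral_add, simp, simp)
       (subst Bochner_Integration.integral_add, simp_all)
  also have "expectation (\<lambda>\<omega>. ?Y \<omega> * X n \<omega>) = 0"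
    by (rule orthogonal[OF partial_sum_adapted partial_sum_bounded])
  finally show ?case using Suc by simp
qed

text \<open>Orthogonality makes the second moment of the \<open>n\<close>-th partial sum at most
  \<open>n * C\<^sup>2\<close>. Along squares \<open>n = m\<^sup>2\<close> the averages have second
  moments at most \<open>C\<^sup>2 / m\<^sup>2\<close>, which are summable; between squares at most
  \<open>2 * m\<close> increments of size \<open>C\<close> are added, negligible against
  \<open>m\<^sup>2\<close>.\<close>

lemma strong_law:
  assumes C: "\<And>n. B n \<le> C"
  shows "AE \<omega> in M. (\<lambda>n. (\<Sum>m<n. X m \<omega>) / real n) \<longlonglongrightarrow> 0"
proof -
  obtain \<omega>0 where "\<omega>0 \<in> space M" using not_empty by auto
  then have C0: "0 \<le> C" using bounded[of \<omega>0 0] C[of 0] by linarith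
  have XC: "\<bar>X n \<omega>\<bar> \<le> C" if "\<omega> \<in> space M" for n \<omega> using bounded[OF that, of n] C[of n] by linarith
  define Y where "Y n \<omega> = (\<Sum>m<n. X m \<omega>)" for n \<omega>
  have sq: "expectation (\<lambda>\<omega>. (X n \<omega>)\<^sup>2) \<le> C\<^sup>2" for n
  proof -
    have "expectation (\<lambda>\<omega>. (X n \<omega>)\<^sup>2) \<le> expectation (\<lambda>\<omega>. C\<^sup>2)"
      using XC C0 by (intro integral_mono integrable_square) (auto simp: abs_le_square_iff[symmetric])
    then show ?thesis by (simp add: prob_space)
  qed
  have Y2: "expectation (\<lambda>\<omega>. (Y n \<omega>)\<^sup>2) \<le> real n * C\<^sup>2" for n
  proof -
    have "(\<Sum>m<n. expectation (\<lambda>\<omega>. (X m \<omega>)\<^sup>2)) \<le> (\<Sum>m<n. C\<^sup>2)"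
      by (intro sum_mono sq)
    then show ?thesis by (simp add: Y_def second_moment)
  qed
  have ev: "expectation (\<lambda>\<omega>. (Y ((Suc m)\<^sup>2) \<omega> / real ((Suc m)\<^sup>2))\<^sup>2) \<le> C\<^sup>2 * (1 / (real (Suc m))\<^sup>2)" for m
  proof -
    have "expectation (\<lambda>\<omega>. (Y ((Suc m)\<^sup>2) \<omega> / real ((Suc m)\<^sup>2))\<^sup>2)
        = expectation (\<lambda>\<omega>. (Y ((Suc m)\<^sup>2) \<omega>)\<^sup>2) / (real ((Suc m)\<^sup>2))\<^sup>2"
      by (simp only: power_divide integral_divide_zero)
    also have "\<dots> \<le> real ((Suc m)\<^sup>2) * C\<^sup>2 / (real ((Suc m)\<^sup>2))\<^sup>2"
      by (intro divide_right_mono Y2) simp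
    also have "\<dots> = C\<^sup>2 * (1 / (real (Suc m))\<^sup>2)"
      unfolding of_nat_power by (simp add: power2_eq_square del: of_nat_Suc)
    finally show ?thesis .
  qed
  have "AE \<omega> in M. (\<lambda>m. Y ((Suc m)\<^sup>2) \<omega> / real ((Suc m)\<^sup>2)) \<longlonglongrightarrow> 0"
  proof (rule AE_tendsto_0_of_summable_second_moments)
    show "integrable M (\<lambda>\<omega>. (Y ((Suc m)\<^sup>2) \<omega> / real ((Suc m)\<^sup>2))\<^sup>2)" for m
      unfolding power_divide Y_def by (intro integrable_divide_zero impI integrable_partial_sum_square)
    have "summable (\<lambda>m. C\<^sup>2 * (1 / (real (Suc m))\<^sup>2))"
      using summable_Suc_iff[of "\<lambda>n. 1 / (real n)\<^sup>2"] inverse_power_summable[of 2, where 'a = real]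
      by (intro summable_mult) (simp add: inverse_eq_divide)
    then show "summable (\<lambda>m. expectation (\<lambda>\<omega>. (Y ((Suc m)\<^sup>2) \<omega> / real ((Suc m)\<^sup>2))\<^sup>2))"
      by (rule summable_comparison_test'[where N = 0]) (use ev in \<open>simp add: integral_nonneg_AE\<close>)
  qed
  then show ?thesis
    using AE_space
  proof eventually_elim
    case (elim \<omega>)
    have Ysq: "(\<lambda>m. \<bar>Y (m\<^sup>2) \<omega> / real (m\<^sup>2)\<bar>) \<longlonglongrightarrow> 0"
      using tendsto_rabs_zero[OF elim(1)] by (rule LIMSEQ_imp_Suc)
    have "filterlim floor_sqrt at_top sequentially"
      unfolding filterlim_at_top
    proof
      fix Z
      show "\<forall>\<^sub>F n in sequentially. Z \<le> floor_sqrt n"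
        using eventually_ge_at_top[of "Z\<^sup>2"]
        by eventually_elim (simp add: le_floor_sqrt_iff)
    qed
    then have "(\<lambda>n. \<bar>Y ((floor_sqrt n)\<^sup>2) \<omega> / real ((floor_sqrt n)\<^sup>2)\<bar> + 2 * C * (1 / real (floor_sqrt n)))
        \<longlonglongrightarrow> 0 + 2 * C * 0"
      by (intro tendsto_intros filterlim_compose[OF Ysq] filterlim_compose[OF lim_1_over_n])
    then have lim: "(\<lambda>n. \<bar>Y ((floor_sqrt n)\<^sup>2) \<omega> / real ((floor_sqrt n)\<^sup>2)\<bar> + 2 * C * (1 / real (floor_sqrt n)))
        \<longlonglongrightarrow> 0" by simp
    have "(\<lambda>n. Y n \<omega> / real n) \<longlonglongrightarrow> 0"
    proof (rule Lim_null_comparison[OF _ lim])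
      show "\<forall>\<^sub>F n in sequentially. norm (Y n \<omega> / real n)
          \<le> \<bar>Y ((floor_sqrt n)\<^sup>2) \<omega> / real ((floor_sqrt n)\<^sup>2)\<bar> + 2 * C * (1 / real (floor_sqrt n))"
        using eventually_gt_at_top[of 0]
      proof eventually_elim
        case n: (elim n)
        define s where "s = floor_sqrt n"
        have s: "s\<^sup>2 \<le> n" "n < (Suc s)\<^sup>2" "s > 0"
          using n Suc_floor_sqrt_power2_gt[of n] by (auto simp: s_def)
        have "Y n \<omega> = Y (s\<^sup>2) \<omega> + (\<Sum>m=s\<^sup>2..<n. X m \<omega>)"
          unfolding Y_def lessThan_atLeast0 using s by (simp add: sum.atLeastLessThan_concat)
        then have "\<bar>Y n \<omega>\<bar> \<le> \<bar>Y (s\<^sup>2) \<omega>\<bar> + (\<Sum>m=s\<^sup>2..<n. \<bar>X m \<omega>\<bar>)"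
          using sum_abs[of "\<lambda>m. X m \<omega>" "{s\<^sup>2..<n}"] by linarith
        also have "(\<Sum>m=s\<^sup>2..<n. \<bar>X m \<omega>\<bar>) \<le> real (n - s\<^sup>2) * C"
          using sum_mono[of "{s\<^sup>2..<n}" "\<lambda>m. \<bar>X m \<omega>\<bar>" "\<lambda>m. C"] XC[OF elim(2)] by simp
        also have "\<dots> \<le> real (2 * s) * C"
        proof (intro mult_right_mono of_nat_mono C0)
          show "n - s\<^sup>2 \<le> 2 * s" using s(2) by (simp add: power2_eq_square)
        qed
        finally have "\<bar>Y n \<omega>\<bar> / real n \<le> (\<bar>Y (s\<^sup>2) \<omega>\<bar> + real (2 * s) * C) / real n"
          by (intro divide_right_mono) auto
        also have "\<dots> \<le> (\<bar>Y (s\<^sup>2) \<omega>\<bar> + real (2 * s) * C) / real (s\<^sup>2)"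
        proof (intro divide_left_mono)
          show "real (s\<^sup>2) \<le> real n" using s by linarith
          show "0 \<le> \<bar>Y (s\<^sup>2) \<omega>\<bar> + real (2 * s) * C" using C0 by simp
          show "0 < real n * real (s\<^sup>2)" using s n by simp
        qed
        also have "\<dots> = \<bar>Y (s\<^sup>2) \<omega> / real (s\<^sup>2)\<bar> + 2 * C * (1 / real s)"
          using s by (simp add: field_simps power2_eq_square)
        finally show ?case by (simp add: s_def)
      qed
    qed
    then show ?case by (simp add: Y_def)
  qed
qed

end

section \<open>The random graph\<close>

locale depref_model = depref_params \<alpha> \<delta> + prob_space M for \<alpha> \<delta> and M :: "'w measure" +
  fixes e :: "nat \<Rightarrow> 'w \<Rightarrow> nat set"
  assumes model: "inverse_power_depref_attachment M \<alpha> \<delta> e"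
begin

abbreviation F :: "nat \<Rightarrow> 'w measure" where "F n \<equiv> graph_filtration M e n"

definition total_weight :: "nat \<Rightarrow> 'w \<Rightarrow> real" where
  "total_weight n \<omega> = (\<Sum>j=1..n. w (vdeg e j n \<omega>))"

definition attach :: "nat \<Rightarrow> nat \<Rightarrow> 'w \<Rightarrow> real" where
  "attach n j \<omega> = of_bool (e (Suc n) \<omega> = {Suc n, j})"

lemma e_measurable: "1 \<le> n \<Longrightarrow> e n \<in> measurable M (count_space UNIV)"
  using model unfolding inverse_power_depref_attachment_def by (elim conjE) simp

lemma e_1: "\<omega> \<in> space M \<Longrightarrow> e 1 \<omega> = {1}"
  using model unfolding inverse_power_depref_attachment_def by (elim conjE) simp

lemma e_Suc: "\<omega> \<in> space M \<Longrightarrow> 1 \<le> n \<Longrightarrow> \<exists>j\<in>{1..n}. e (Suc n) \<omega> = {Suc n, j}"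
  using model unfolding inverse_power_depref_attachment_def by (elim conjE) simp

lemma cond_exp_attach: "1 \<le> n \<Longrightarrow> j \<in> {1..n} \<Longrightarrow> AE \<omega> in M.
    real_cond_exp M (F n) (indicator {\<omega> \<in> space M. e (Suc n) \<omega> = {Suc n, j}}) \<omega>
    = attach_normalizer \<alpha> \<delta> e n \<omega> / (\<delta> + real (vdeg e j n \<omega>)) powr \<alpha>"
  using model unfolding inverse_power_depref_attachment_def by (elim conjE) simp

text \<open>The dangling half-edge of the initial vertex fits the common pattern as
  \<open>{1, 1}\<close>.\<close>

lemma e_cases:
  assumes "\<omega> \<in> space M" "1 \<le> n"
  obtains j where "j \<in> {1..n}" "e n \<omega> = {n, j}"
proof (cases n rule: nat.exhaust)
  case (Suc m)
  show thesis
  proof (cases "m = 0")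
    case True
    then show thesis using e_1[OF assms(1)] Suc that[of 1] by simp
  next
    case False
    then obtain j where "j \<in> {1..m}" "e (Suc m) \<omega> = {Suc m, j}" using e_Suc[OF assms(1), of m] by auto
    then show thesis using Suc that[of j] by simp
  qed
qed (use assms in simp)

lemma e_subset:
  assumes "\<omega> \<in> space M" "1 \<le> n"
  shows "e n \<omega> \<subseteq> {1..n}"
  using e_cases[OF assms] assms(2) by (metis atLeastAtMost_iff empty_subsetI insert_subset order_refl)

lemma e_self:
  assumes "\<omega> \<in> space M" "1 \<le> n"
  shows "n \<in> e n \<omega>"
  using e_cases[OF assms] by (metis insertI1)

lemma space_F [simp]: "space (F n) = space M"
  unfolding graph_filtration_def by (rule space_measure_of) auto

lemma sets_F: "sets (F n) = sigma_sets (space M) {e m -` S \<inter> space M | m S. m \<in> {1..n}}"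
  unfolding graph_filtration_def by (rule sets_measure_of) auto

lemma subalgebra_F: "subalgebra M (F n)"
  unfolding subalgebra_def sets_F
  by (auto intro!: sets.sigma_sets_subset measurable_sets[OF e_measurable])

lemma F_mono: "m \<le> n \<Longrightarrow> subalgebra (F n) (F m)"
  unfolding subalgebra_def sets_F
  by (intro conjI sigma_sets_mono') (simp, use order.trans in fastforce)

lemma e_adapted: "1 \<le> m \<Longrightarrow> m \<le> n \<Longrightarrow> e m \<in> measurable (F n) (count_space UNIV)"
  by (rule measurableI) (auto simp: sets_F intro!: sigma_sets.Basic)

lemma e_event_adapted:
  "1 \<le> m \<Longrightarrow> m \<le> n \<Longrightarrow> (\<lambda>\<omega>. of_bool (Q (e m \<omega>)) :: real) \<in> borel_measurable (F n)"
  by (rule measurable_compose[OF e_adapted]) auto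

lemma attach_adapted: "attach n j \<in> borel_measurable (F (Suc n))"
  unfolding attach_def[abs_def] by (rule e_event_adapted) auto

lemma attach_measurable [measurable]: "attach n j \<in> borel_measurable M"
  by (rule measurable_from_subalg[OF subalgebra_F attach_adapted])

lemma vdeg_adapted: "vdeg e j n \<in> measurable (F n) (count_space UNIV)"
proof -
  have r: "(\<lambda>\<omega>. real (vdeg e j n \<omega>)) \<in> borel_measurable (F n)"
  proof -
    have "(\<lambda>\<omega>. \<Sum>m=1..n. of_bool (j \<in> e m \<omega>) :: real) \<in> borel_measurable (F n)"
      by (intro borel_measurable_sum e_event_adapted) auto
    moreover have "(\<Sum>m=1..n. of_bool (j \<in> e m \<omega>) :: real) = real (vdeg e j n \<omega>)" for \<omega>
      by (simp add: vdeg_def sum.If_cases of_bool_def Int_def)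
    ultimately show ?thesis by simp
  qed
  show ?thesis
  proof (subst measurable_count_space_eq2_countable, intro conjI ballI)
    fix k
    have "(\<lambda>\<omega>. real (vdeg e j n \<omega>)) -` {real k} \<inter> space (F n) \<in> sets (F n)"
      by (rule measurable_sets[OF r]) simp
    moreover have "(\<lambda>\<omega>. real (vdeg e j n \<omega>)) -` {real k} = vdeg e j n -` {k}" by auto
    ultimately show "vdeg e j n -` {k} \<inter> space (F n) \<in> sets (F n)" by simp
  qed auto
qed

lemma vdeg_measurable [measurable]: "vdeg e j n \<in> measurable M (count_space UNIV)"
  by (rule measurable_from_subalg[OF subalgebra_F vdeg_adapted])

lemma vdeg_fun_adapted: "(\<lambda>\<omega>. g (vdeg e j n \<omega>) :: real) \<in> borel_measurable (F n)"
  by (rule measurable_compose[OF vdeg_adapted]) auto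

lemma vdeg_fun_measurable [measurable]: "(\<lambda>\<omega>. g (vdeg e j n \<omega>) :: real) \<in> borel_measurable M"
  by (rule measurable_from_subalg[OF subalgebra_F vdeg_fun_adapted])

lemma total_weight_adapted: "total_weight n \<in> borel_measurable (F n)"
  unfolding total_weight_def[abs_def] by (intro borel_measurable_sum vdeg_fun_adapted)

lemma total_weight_measurable [measurable]: "total_weight n \<in> borel_measurable M"
  by (rule measurable_from_subalg[OF subalgebra_F total_weight_adapted])

lemma vdeg_Suc:
  assumes "\<omega> \<in> space M" "1 \<le> j" "j \<le> n"
  shows "vdeg e j (Suc n) \<omega> = vdeg e j n \<omega> + of_bool (e (Suc n) \<omega> = {Suc n, j})"
proof -
  have "1 \<le> n" using assms by simp
  then obtain i where i: "i \<in> {1..n}" "e (Suc n) \<omega> = {Suc n, i}" using e_Suc assms by blast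
  have "j \<in> e (Suc n) \<omega> \<longleftrightarrow> e (Suc n) \<omega> = {Suc n, j}" using i assms by (auto simp: doubleton_eq_iff)
  moreover have "{m \<in> {1..Suc n}. j \<in> e m \<omega>} =
      (if j \<in> e (Suc n) \<omega> then insert (Suc n) {m \<in> {1..n}. j \<in> e m \<omega>} else {m \<in> {1..n}. j \<in> e m \<omega>})"
    by (auto simp: le_Suc_eq)
  ultimately show ?thesis by (simp add: vdeg_def)
qed

lemma vdeg_new:
  assumes "\<omega> \<in> space M" "1 \<le> n"
  shows "vdeg e n n \<omega> = 1"
proof -
  have "{m \<in> {1..n}. n \<in> e m \<omega>} = {n}"
  proof (intro set_eqI iffI)
    fix m assume "m \<in> {m \<in> {1..n}. n \<in> e m \<omega>}"
    then have "m \<in> {1..n}" "n \<in> e m \<omega>" by auto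
    moreover have "e m \<omega> \<subseteq> {1..m}" using e_subset assms calculation by auto
    ultimately show "m \<in> {n}" by auto
  qed (use assms e_self in auto)
  then show ?thesis by (simp add: vdeg_def)
qed

lemma vdeg_pos: "\<omega> \<in> space M \<Longrightarrow> 1 \<le> j \<Longrightarrow> j \<le> n \<Longrightarrow> 1 \<le> vdeg e j n \<omega>"
proof -
  assume a: "\<omega> \<in> space M" "1 \<le> j" "j \<le> n"
  from a(3) show ?thesis
  proof (induction n rule: dec_induct)
    case base then show ?case using vdeg_new a by simp
  next
    case (step n) then show ?case using vdeg_Suc[of \<omega> j n] a by simp
  qed
qed

lemma vdeg_le: "vdeg e j n \<omega> \<le> n"
proof -
  have "card {m \<in> {1..n}. j \<in> e m \<omega>} \<le> card {1..n}" by (rule card_mono) auto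
  then show ?thesis by (simp add: vdeg_def)
qed

lemma sum_attach:
  assumes "\<omega> \<in> space M" "1 \<le> n"
  obtains i where "i \<in> {1..n}" "e (Suc n) \<omega> = {Suc n, i}"
    "\<And>g :: nat \<Rightarrow> real. (\<Sum>j=1..n. g j * attach n j \<omega>) = g i"
proof -
  obtain i where i: "i \<in> {1..n}" "e (Suc n) \<omega> = {Suc n, i}" using e_Suc assms by blast
  have "(\<Sum>j=1..n. g j * attach n j \<omega>) = g i" for g :: "nat \<Rightarrow> real"
  proof -
    have "g j * attach n j \<omega> = (if j = i then g j else 0)" if "j \<in> {1..n}" for j
      using that i by (auto simp: attach_def doubleton_eq_iff)
    then have "(\<Sum>j=1..n. g j * attach n j \<omega>) = (\<Sum>j=1..n. if j = i then g j else 0)"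
      by (intro sum.cong) auto
    then show ?thesis using i by simp
  qed
  then show ?thesis using that i by blast
qed

lemma w_deg_pos: "\<omega> \<in> space M \<Longrightarrow> j \<in> {1..n} \<Longrightarrow> 0 < w (vdeg e j n \<omega>)"
  using vdeg_pos[of \<omega> j n] by (intro w_pos) auto

lemma total_weight_pos: "\<omega> \<in> space M \<Longrightarrow> 1 \<le> n \<Longrightarrow> 0 < total_weight n \<omega>"
  unfolding total_weight_def by (intro sum_pos w_deg_pos) auto

lemma attach_probability_nonneg: "\<omega> \<in> space M \<Longrightarrow> 0 \<le> w (vdeg e j n \<omega>) / total_weight n \<omega>"
  unfolding total_weight_def by (intro divide_nonneg_nonneg sum_nonneg w_nonneg)

lemma sum_attach_probability: "\<omega> \<in> space M \<Longrightarrow> 1 \<le> n \<Longrightarrow> (\<Sum>j=1..n. w (vdeg e j n \<omega>) / total_weight n \<omega>) = 1"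
  using total_weight_pos[of \<omega> n] by (simp add: sum_divide_distrib[symmetric] total_weight_def)

lemma attach_probability_le_1:
  "\<omega> \<in> space M \<Longrightarrow> j \<in> {1..n} \<Longrightarrow> w (vdeg e j n \<omega>) / total_weight n \<omega> \<le> 1"
proof -
  assume a: "\<omega> \<in> space M" "j \<in> {1..n}"
  have "w (vdeg e j n \<omega>) / total_weight n \<omega> \<le> (\<Sum>j=1..n. w (vdeg e j n \<omega>) / total_weight n \<omega>)"
    by (rule member_le_sum) (use a attach_probability_nonneg in auto)
  also have "\<dots> = 1" using a by (intro sum_attach_probability) auto
  finally show ?thesis .
qed

text \<open>The only place where the attachment law of the model enters. Afterwards conditional
  expectations are replaced by this identity for bounded functions of the past.\<close>

lemma expectation_attach:
  assumes n: "1 \<le> n" and j: "j \<in> {1..n}"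
    and Z: "Z \<in> borel_measurable (F n)" and bd: "\<And>\<omega>. \<omega> \<in> space M \<Longrightarrow> \<bar>Z \<omega>\<bar> \<le> C"
  shows "expectation (\<lambda>\<omega>. Z \<omega> * attach n j \<omega>)
      = expectation (\<lambda>\<omega>. Z \<omega> * (w (vdeg e j n \<omega>) / total_weight n \<omega>))"
proof -
  interpret finite_measure_subalgebra M "F n" by standard (rule subalgebra_F)
  have Zm [measurable]: "Z \<in> borel_measurable M" by (rule measurable_from_subalg[OF subalgebra_F Z])
  let ?A = "{\<omega> \<in> space M. e (Suc n) \<omega> = {Suc n, j}}"
  have A: "?A \<in> sets M"
    using measurable_sets[OF e_measurable[of "Suc n"], of "{{Suc n, j}}"]
    by (simp add: vimage_def Int_def conj_commute)
  have att: "attach n j \<omega> = indicator ?A \<omega>" if "\<omega> \<in> space M" for \<omega>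
    using that by (simp add: attach_def indicator_def)
  have "expectation (\<lambda>\<omega>. Z \<omega> * attach n j \<omega>) = expectation (\<lambda>\<omega>. Z \<omega> * indicator ?A \<omega>)"
    by (intro Bochner_Integration.integral_cong) (auto simp: att)
  also have "\<dots> = expectation (\<lambda>\<omega>. Z \<omega> * real_cond_exp M (F n) (indicator ?A) \<omega>)"
  proof (rule real_cond_exp_intg(2)[symmetric])
    show "integrable M (\<lambda>\<omega>. Z \<omega> * indicator ?A \<omega>)"
      using A by (intro integrable_const_bound[where B = C] AE_I2)
        (auto simp: indicator_def intro: bd order.trans[OF _ bd] order.trans[OF abs_ge_zero bd])
  qed (use A Z in auto)
  also have "\<dots> = expectation (\<lambda>\<omega>. Z \<omega> * (w (vdeg e j n \<omega>) / total_weight n \<omega>))"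
  proof (rule integral_cong_AE)
    show "AE \<omega> in M. Z \<omega> * real_cond_exp M (F n) (indicator ?A) \<omega> =
        Z \<omega> * (w (vdeg e j n \<omega>) / total_weight n \<omega>)"
      using cond_exp_attach[OF n j]
      by eventually_elim (simp add: attach_normalizer_def total_weight_def w_def f_def field_simps)
  qed auto
  finally show ?thesis .
qed

text \<open>The centred gain when an edge to vertex \<open>j\<close> is rewarded with
  \<open>g j\<close>. Both martingales are instances: \<open>g\<close> marks the vertices of degree
  \<open>k\<close> for the tails, and is \<open>f\<close> of the degree at a single vertex for the
  fixed-vertex analysis.\<close>

definition noise :: "nat \<Rightarrow> (nat \<Rightarrow> 'w \<Rightarrow> real) \<Rightarrow> 'w \<Rightarrow> real" where
  "noise n g \<omega> = (\<Sum>j=1..n. g j \<omega> * (attach n j \<omega> - w (vdeg e j n \<omega>) / total_weight n \<omega>))"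

lemma noise_adapted:
  assumes "\<And>j. j \<in> {1..n} \<Longrightarrow> g j \<in> borel_measurable (F n)"
  shows "noise n g \<in> borel_measurable (F (Suc n))"
proof -
  note lift = measurable_from_subalg[OF F_mono[of n "Suc n"]]
  show ?thesis
    unfolding noise_def[abs_def]
    by (intro borel_measurable_sum borel_measurable_times borel_measurable_diff borel_measurable_divide
        attach_adapted lift[OF _ vdeg_fun_adapted] lift[OF _ total_weight_adapted] lift[OF _ assms]) auto
qed

text \<open>Over \<open>j\<close>, the attachment indicators and the attachment probabilities each
  sum to 1, so each contributes at most \<open>C\<close>, independently of the number of
  vertices.\<close>

lemma noise_bounded:
  assumes w: "\<omega> \<in> space M" and g: "\<And>j. j \<in> {1..n} \<Longrightarrow> \<bar>g j \<omega>\<bar> \<le> C" and C: "0 \<le> C"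
  shows "\<bar>noise n g \<omega>\<bar> \<le> 2 * C"
proof (cases "1 \<le> n")
  case True
  obtain i where i: "\<And>h :: nat \<Rightarrow> real. (\<Sum>j=1..n. h j * attach n j \<omega>) = h i" using sum_attach[OF w True] by metis
  let ?p = "\<lambda>j. w (vdeg e j n \<omega>) / total_weight n \<omega>"
  have "\<bar>noise n g \<omega>\<bar> \<le> (\<Sum>j=1..n. \<bar>g j \<omega> * (attach n j \<omega> - ?p j)\<bar>)"
    unfolding noise_def by (rule sum_abs)
  also have "\<dots> \<le> (\<Sum>j=1..n. C * attach n j \<omega> + C * ?p j)"
  proof (intro sum_mono)
    fix j assume j: "j \<in> {1..n}"
    have "\<bar>attach n j \<omega> - ?p j\<bar> \<le> attach n j \<omega> + ?p j"
      using attach_probability_nonneg[OF w, of j n] by (auto simp: attach_def abs_if)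
    then have "\<bar>g j \<omega>\<bar> * \<bar>attach n j \<omega> - ?p j\<bar> \<le> C * (attach n j \<omega> + ?p j)"
      using g[OF j] C by (intro mult_mono) auto
    then show "\<bar>g j \<omega> * (attach n j \<omega> - ?p j)\<bar> \<le> C * attach n j \<omega> + C * ?p j"
      by (simp add: abs_mult distrib_left)
  qed
  also have "\<dots> = C + C * 1"
    using i[of "\<lambda>_. C"] sum_attach_probability[OF w True]
    by (simp add: sum.distrib sum_distrib_left[symmetric] del: times_divide_eq_right)
  finally show ?thesis by simp
next
  case False then show ?thesis using C by (simp add: noise_def)
qed

lemma bounded_integrable:
  "g \<in> borel_measurable M \<Longrightarrow> (\<And>\<omega>. \<omega> \<in> space M \<Longrightarrow> \<bar>g \<omega>\<bar> \<le> C) \<Longrightarrow> integrable M (g :: 'w \<Rightarrow> real)"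
  by (rule integrable_const_bound[where B = C]) auto

lemma noise_orthogonal:
  assumes g: "\<And>j. j \<in> {1..n} \<Longrightarrow> g j \<in> borel_measurable (F n)"
    and gb: "\<And>j \<omega>. \<omega> \<in> space M \<Longrightarrow> j \<in> {1..n} \<Longrightarrow> \<bar>g j \<omega>\<bar> \<le> C"
    and Z: "Z \<in> borel_measurable (F n)" and Zb: "\<And>\<omega>. \<omega> \<in> space M \<Longrightarrow> \<bar>Z \<omega>\<bar> \<le> C'"
  shows "expectation (\<lambda>\<omega>. Z \<omega> * noise n g \<omega>) = 0"
proof -
  let ?p = "\<lambda>j \<omega>. w (vdeg e j n \<omega>) / total_weight n \<omega>"
  have Zg: "(\<lambda>\<omega>. Z \<omega> * g j \<omega>) \<in> borel_measurable (F n)" if "j \<in> {1..n}" for j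
    using g[OF that] Z by simp
  have Zgb: "\<bar>Z \<omega> * g j \<omega>\<bar> \<le> C' * C" if "\<omega> \<in> space M" "j \<in> {1..n}" for j \<omega>
    unfolding abs_mult using Zb[OF that(1)] gb[OF that] by (intro mult_mono) auto
  have ZgM: "(\<lambda>\<omega>. Z \<omega> * g j \<omega>) \<in> borel_measurable M" if "j \<in> {1..n}" for j
    by (rule measurable_from_subalg[OF subalgebra_F Zg[OF that]])
  have i1: "integrable M (\<lambda>\<omega>. (Z \<omega> * g j \<omega>) * attach n j \<omega>)" if j: "j \<in> {1..n}" for j
  proof (rule bounded_integrable)
    show "\<bar>(Z \<omega> * g j \<omega>) * attach n j \<omega>\<bar> \<le> (C' * C) * 1" if "\<omega> \<in> space M" for \<omega>
      unfolding abs_mult[of _ "attach n j \<omega>"]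
      using Zgb[OF that j] by (intro mult_mono) (auto simp: attach_def)
  qed (use ZgM[OF j] in measurable)
  have i2: "integrable M (\<lambda>\<omega>. (Z \<omega> * g j \<omega>) * ?p j \<omega>)" if j: "j \<in> {1..n}" for j
  proof (rule bounded_integrable)
    show "\<bar>(Z \<omega> * g j \<omega>) * ?p j \<omega>\<bar> \<le> (C' * C) * 1" if "\<omega> \<in> space M" for \<omega>
      unfolding abs_mult[of _ "?p j \<omega>"]
      using Zgb[OF that j] attach_probability_le_1[OF that j] attach_probability_nonneg[OF that, of j n]
      by (intro mult_mono) auto
  qed (use ZgM[OF j] in measurable)
  have "expectation (\<lambda>\<omega>. Z \<omega> * noise n g \<omega>)
      = expectation (\<lambda>\<omega>. \<Sum>j=1..n. (Z \<omega> * g j \<omega>) * attach n j \<omega> - (Z \<omega> * g j \<omega>) * ?p j \<omega>)"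
    by (simp add: noise_def sum_distrib_left right_diff_distrib mult.assoc)
  also have "\<dots> = (\<Sum>j=1..n. expectation (\<lambda>\<omega>. (Z \<omega> * g j \<omega>) * attach n j \<omega>)
      - expectation (\<lambda>\<omega>. (Z \<omega> * g j \<omega>) * ?p j \<omega>))"
    using i1 i2 by (subst Bochner_Integration.integral_sum) (auto intro!: sum.cong)
  also have "\<dots> = 0"
    using expectation_attach[OF _ _ Zg Zgb] by (intro sum.neutral) auto
  finally show ?thesis .
qed

text \<open>The process is set to zero before time \<open>N\<close>: there is no attachment before
  time 1, and a fixed vertex \<open>i\<close> exists only from time \<open>i\<close> on.\<close>

lemma noise_process:
  assumes g: "\<And>n j. n \<ge> N \<Longrightarrow> j \<in> {1..n} \<Longrightarrow> g n j \<in> borel_measurable (F n)"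
    and gb: "\<And>n j \<omega>. n \<ge> N \<Longrightarrow> \<omega> \<in> space M \<Longrightarrow> j \<in> {1..n} \<Longrightarrow> \<bar>g n j \<omega>\<bar> \<le> C n"
    and C: "\<And>n. 0 \<le> C n"
  shows "bounded_noise M F (\<lambda>n. if n \<ge> N then noise n (g n) else (\<lambda>_. 0)) (\<lambda>n. 2 * C n)"
proof
  fix n
  show "(if n \<ge> N then noise n (g n) else (\<lambda>_. 0)) \<in> borel_measurable (F (Suc n))"
    using noise_adapted[OF g] by auto
  show "\<bar>(if n \<ge> N then noise n (g n) else (\<lambda>_. 0)) \<omega>\<bar> \<le> 2 * C n" if "\<omega> \<in> space M" for \<omega>
    using noise_bounded[of \<omega> n "g n" "C n"] gb[of n \<omega>] C[of n] that by auto
  show "expectation (\<lambda>\<omega>. Z \<omega> * (if n \<ge> N then noise n (g n) else (\<lambda>_. 0)) \<omega>) = 0"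
    if "Z \<in> borel_measurable (F n)" "\<And>\<omega>. \<omega> \<in> space M \<Longrightarrow> \<bar>Z \<omega>\<bar> \<le> C'" for Z C'
    using noise_orthogonal[of n "g n" "C n" Z C'] g[of n] gb[of n] that by auto
qed (auto intro: subalgebra_F F_mono)

end

section \<open>Weights and partial sums of \<open>f\<close> as functions of a degree\<close>

context depref_params
begin

text \<open>The weight is \<open>w 1\<close> minus the decrements at the levels passed so far;
  truncation at \<open>K\<close> keeps the sum finite. Summed over the vertices, this writes the
  weight as a linear function of the tails.\<close>

lemma weight_layer_cake:
  assumes "1 \<le> d" "1 \<le> K"
  shows "w 1 - (\<Sum>k=1..<K. (w k - w (Suc k)) * of_bool (Suc k \<le> d)) = w (min d K)"
  using assms(2)
proof (induction K rule: dec_induct)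
  case base then show ?case using assms by (simp add: min_def)
next
  case (step K)
  then show ?case using assms by (cases "Suc K \<le> d") (simp_all add: min_def)
qed

lemma weight_truncation:
  assumes "1 \<le> d" "1 \<le> K"
  shows "w d \<le> w (min d K)" "w (min d K) \<le> w d + w K"
  using assms w_nonneg[of K] w_nonneg[of d] by (auto simp: min_def intro: w_antimono)

text \<open>A linear minorant of \<open>w\<close> that vanishes at 4, twice the bound 2 for the
  average degree. Averaged over the vertices it leaves at least \<open>w 4 / 2\<close> per vertex,
  which is \<open>min_rate\<close>.\<close>

lemma weight_lower_bound:
  assumes "1 \<le> d"
  shows "w 4 * (1 - real d / 4) \<le> w d"
proof (cases "d \<le> 4")
  case True
  have "w 4 * (1 - real d / 4) \<le> w 4 * 1" by (intro mult_left_mono w_nonneg) simp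
  also have "\<dots> \<le> w d" using w_antimono[OF assms True] by simp
  finally show ?thesis .
next
  case False
  then have "w 4 * (1 - real d / 4) \<le> 0" using w_nonneg[of 4] by (intro mult_nonneg_nonpos) auto
  then show ?thesis using w_nonneg[of d] by linarith
qed

definition cum_f :: "nat \<Rightarrow> real" where "cum_f d = (\<Sum>j=1..<d. f j)"

lemma cum_f_0 [simp]: "cum_f 0 = 0" and cum_f_1 [simp]: "cum_f (Suc 0) = 0"
  by (simp_all add: cum_f_def)

lemma cum_f_Suc: "1 \<le> d \<Longrightarrow> cum_f (Suc d) = cum_f d + f d"
  by (simp add: cum_f_def)

lemma cum_f_mono: "d \<le> d' \<Longrightarrow> cum_f d \<le> cum_f d'"
  unfolding cum_f_def by (intro sum_mono2) (auto simp: f_nonneg)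

lemma cum_f_nonneg: "0 \<le> cum_f d"
  unfolding cum_f_def by (intro sum_nonneg f_nonneg)

text \<open>Here \<open>\<alpha> \<le> 1\<close> is used: the increments of \<open>f\<close> are bounded.\<close>

lemma f_square_le:
  obtains C where "0 < C" "\<And>d. 1 \<le> d \<Longrightarrow> (f d)\<^sup>2 \<le> C * (1 + cum_f d)"
proof -
  \<comment> \<open>A bound for the increments of \<open>f\<close>: from
    \<open>(1 + 1 / x) powr \<alpha> \<le> 1 + 1 / x\<close> the increment at
    \<open>x = \<delta> + d\<close> is at most \<open>x powr (\<alpha> - 1)\<close>, which is
    largest at \<open>x = \<delta> + 1\<close>.\<close>
  define a where "a = (\<delta> + 1) powr (\<alpha> - 1)"
  have a: "a \<ge> 0" by (simp add: a_def)
  have f1: "f 1 > 0" by (rule f_pos) simp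
  have step: "f (Suc d) \<le> f d + a" if d: "1 \<le> d" for d
  proof -
    define x where "x = \<delta> + real d"
    have x: "x > 0" "x \<ge> \<delta> + 1" using shifted_pos[OF d] d by (auto simp: x_def)
    have "\<delta> + real (Suc d) = x * (1 + 1 / x)" using x by (simp add: x_def distrib_left)
    then have "f (Suc d) = (x * (1 + 1 / x)) powr \<alpha>" by (simp only: f_def)
    also have "\<dots> = x powr \<alpha> * (1 + 1 / x) powr \<alpha>" using x by (simp add: powr_mult)
    also have "\<dots> \<le> x powr \<alpha> * (1 + 1 / x) powr 1"
      using x alpha_le_1 by (intro mult_left_mono powr_mono) auto
    also have "\<dots> = f d + x powr (\<alpha> - 1)"
      using x by (simp add: powr_diff f_def x_def field_simps)
    also have "x powr (\<alpha> - 1) \<le> a"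
      unfolding a_def using x alpha_le_1 delta_gt by (intro powr_mono2') auto
    finally show ?thesis by simp
  qed
  \<comment> \<open>Squaring \<open>f d + a\<close> adds \<open>2 * a * f d + a\<^sup>2\<close>; the
    constant part is absorbed into a multiple of \<open>f d\<close> because
    \<open>f 1 \<le> f d\<close>.\<close>
  define b where "b = 2 * a + a\<^sup>2 / f 1"
  have b: "b \<ge> 0" using a f1 by (simp add: b_def)
  have main: "(f d)\<^sup>2 \<le> (f 1)\<^sup>2 + b * cum_f d" if "1 \<le> d" for d
    using that
  proof (induction d rule: dec_induct)
    case base then show ?case by simp
  next
    case (step d)
    have fd: "f 1 \<le> f d" using step by (intro f_mono) auto
    have "(f (Suc d))\<^sup>2 \<le> (f d + a)\<^sup>2"
      using \<open>\<And>d. 1 \<le> d \<Longrightarrow> f (Suc d) \<le> f d + a\<close>[of d] step f_nonneg by (intro power_mono) auto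
    also have "\<dots> = (f d)\<^sup>2 + 2 * a * f d + a\<^sup>2 / f 1 * f 1" using f1 by (simp add: power2_sum)
    also have "a\<^sup>2 / f 1 * f 1 \<le> a\<^sup>2 / f 1 * f d" using fd f1 by (intro mult_left_mono) auto
    finally have "(f (Suc d))\<^sup>2 \<le> (f d)\<^sup>2 + b * f d" by (simp add: b_def algebra_simps)
    then show ?case using step.IH step.hyps by (simp add: cum_f_Suc distrib_left)
  qed
  show ?thesis
  proof
    show "0 < (f 1)\<^sup>2 + b" using f1 b by (intro add_pos_nonneg) auto
    fix d :: nat assume d: "1 \<le> d"
    have "(f d)\<^sup>2 \<le> (f 1)\<^sup>2 + b * cum_f d" by (rule main[OF d])
    also have "\<dots> \<le> ((f 1)\<^sup>2 + b) * (1 + cum_f d)"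
      using b cum_f_nonneg[of d] by (simp add: algebra_simps)
    finally show "(f d)\<^sup>2 \<le> ((f 1)\<^sup>2 + b) * (1 + cum_f d)" .
  qed
qed

text \<open>A comparison with the integral of \<open>f\<close>: by the mean value theorem each
  increment of \<open>g\<close> lies between \<open>(1 + \<alpha>) * f j\<close> and
  \<open>(1 + \<alpha>) * f (Suc j)\<close>. The two resulting bounds differ by a term of order
  \<open>d powr \<alpha>\<close>, one power below the main term.\<close>

lemma cum_f_asymptotic:
  "(\<lambda>d. (1 + \<alpha>) * cum_f d / real d powr (1 + \<alpha>)) \<longlonglongrightarrow> 1"
proof -
  define g where "g j = (\<delta> + real j) powr (1 + \<alpha>)" for j
  have diff: "(1 + \<alpha>) * f j \<le> g (Suc j) - g j" "g (Suc j) - g j \<le> (1 + \<alpha>) * f (Suc j)" if j: "1 \<le> j" for j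
  proof -
    let ?x = "\<delta> + real j"
    have x: "?x > 0" using shifted_pos[OF j] .
    have "\<exists>z. ?x < z \<and> z < ?x + 1 \<and> (?x + 1) powr (1 + \<alpha>) - ?x powr (1 + \<alpha>)
        = (?x + 1 - ?x) * ((1 + \<alpha>) * z powr (1 + \<alpha> - 1))"
      using x by (intro MVT2 has_real_derivative_powr) auto
    then obtain z where z: "?x < z" "z < ?x + 1" "g (Suc j) - g j = (1 + \<alpha>) * z powr \<alpha>"
      by (auto simp: g_def add_ac)
    have "f j \<le> z powr \<alpha>" "z powr \<alpha> \<le> f (Suc j)"
      unfolding f_def using z x alpha_pos by (auto intro!: powr_mono2)
    then show "(1 + \<alpha>) * f j \<le> g (Suc j) - g j" "g (Suc j) - g j \<le> (1 + \<alpha>) * f (Suc j)"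
      using alpha_pos z(3) by auto
  qed
  have bounds: "(1 + \<alpha>) * cum_f d \<le> g d \<and> g d - g 1 - (1 + \<alpha>) * f d \<le> (1 + \<alpha>) * cum_f d" if "1 \<le> d" for d
    using that
  proof (induction d rule: dec_induct)
    case base then show ?case using alpha_pos f_nonneg[of 1] by (simp add: g_def)
  next
    case (step d)
    have "(1 + \<alpha>) * cum_f (Suc d) = (1 + \<alpha>) * cum_f d + (1 + \<alpha>) * f d"
      using step by (simp add: cum_f_Suc distrib_left)
    then show ?case using step.IH diff[OF step.hyps(1)] by linarith
  qed
  have ratio: "(\<lambda>d. (\<delta> + real d) / real d) \<longlonglongrightarrow> 1"
  proof -
    have "(\<lambda>d. \<delta> * (1 / real d) + 1) \<longlonglongrightarrow> \<delta> * 0 + 1"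
      by (intro tendsto_intros lim_1_over_n)
    moreover have "\<forall>\<^sub>F d in sequentially. \<delta> * (1 / real d) + 1 = (\<delta> + real d) / real d"
      using eventually_gt_at_top[of 0] by eventually_elim (simp add: field_simps)
    ultimately show ?thesis by (auto intro: Lim_transform_eventually)
  qed
  have inv: "(\<lambda>d. 1 / real d powr (1 + \<alpha>)) \<longlonglongrightarrow> 0"
  proof -
    have "(\<lambda>d. real d powr - (1 + \<alpha>)) \<longlonglongrightarrow> 0"
      using alpha_pos by (intro tendsto_neg_powr filterlim_real_sequentially) auto
    then show ?thesis unfolding powr_minus by (simp add: divide_inverse)
  qed
  have g1: "(\<lambda>d. ((\<delta> + real d) / real d) powr (1 + \<alpha>)) \<longlonglongrightarrow> 1"
    using tendsto_powr[OF ratio tendsto_const, of "1 + \<alpha>"] by simp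
  have g2: "(\<lambda>d. ((\<delta> + real d) / real d) powr \<alpha>) \<longlonglongrightarrow> 1"
    using tendsto_powr[OF ratio tendsto_const, of "\<alpha>"] by simp
  have "(\<lambda>d. ((\<delta> + real d) / real d) powr (1 + \<alpha>) - g 1 * (1 / real d powr (1 + \<alpha>))
      - (1 + \<alpha>) * (((\<delta> + real d) / real d) powr \<alpha> * (1 / real d))) \<longlonglongrightarrow> 1 - g 1 * 0 - (1 + \<alpha>) * (1 * 0)"
    by (intro tendsto_intros g1 g2 inv lim_1_over_n)
  then have lim: "(\<lambda>d. ((\<delta> + real d) / real d) powr (1 + \<alpha>) - g 1 / real d powr (1 + \<alpha>)
      - (1 + \<alpha>) * ((\<delta> + real d) / real d) powr \<alpha> / real d) \<longlonglongrightarrow> 1" by simp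
  show ?thesis
  proof (rule tendsto_sandwich[OF _ _ lim g1])
    show "\<forall>\<^sub>F d in sequentially. (1 + \<alpha>) * cum_f d / real d powr (1 + \<alpha>) \<le> ((\<delta> + real d) / real d) powr (1 + \<alpha>)"
      using eventually_gt_at_top[of 0]
    proof eventually_elim
      case (elim d)
      have "\<delta> + real d > 0" using shifted_pos[of d] elim by simp
      then have "g d / real d powr (1 + \<alpha>) = ((\<delta> + real d) / real d) powr (1 + \<alpha>)"
        by (simp add: g_def powr_divide)
      moreover have "(1 + \<alpha>) * cum_f d / real d powr (1 + \<alpha>) \<le> g d / real d powr (1 + \<alpha>)"
        using bounds[of d] elim by (intro divide_right_mono) auto
      ultimately show ?case by simp
    qed
    show "\<forall>\<^sub>F d in sequentially. ((\<delta> + real d) / real d) powr (1 + \<alpha>) - g 1 / real d powr (1 + \<alpha>)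
      - (1 + \<alpha>) * ((\<delta> + real d) / real d) powr \<alpha> / real d \<le> (1 + \<alpha>) * cum_f d / real d powr (1 + \<alpha>)"
      using eventually_gt_at_top[of 0]
    proof eventually_elim
      case (elim d)
      have p: "\<delta> + real d > 0" using shifted_pos[of d] elim by simp
      then have "g d / real d powr (1 + \<alpha>) = ((\<delta> + real d) / real d) powr (1 + \<alpha>)"
        by (simp add: g_def powr_divide)
      moreover have "f d / real d powr (1 + \<alpha>) = ((\<delta> + real d) / real d) powr \<alpha> / real d"
        using p elim by (simp add: f_def powr_divide powr_add field_simps)
      then have "(1 + \<alpha>) * f d / real d powr (1 + \<alpha>) = (1 + \<alpha>) * ((\<delta> + real d) / real d) powr \<alpha> / real d"
        by (metis times_divide_eq_right)
      moreover have "(g d - g 1 - (1 + \<alpha>) * f d) / real d powr (1 + \<alpha>) \<le> (1 + \<alpha>) * cum_f d / real d powr (1 + \<alpha>)"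
        using bounds[of d] elim by (intro divide_right_mono) auto
      ultimately show ?case by (simp add: diff_divide_distrib)
    qed
  qed
qed

end

lemma sum_inverse_le_ln:
  assumes "1 \<le> n"
  shows "(\<Sum>m=1..<n. 1 / real m) \<le> 1 + ln (real n)"
proof -
  obtain m where m: "n = Suc m" using assms by (cases n) auto
  have "(\<Sum>m=1..<n. 1 / real m) \<le> harm n"
    unfolding harm_def inverse_eq_divide by (intro sum_mono2) auto
  also have "harm n \<le> 1 + ln (real n)"
  proof -
    have "harm (Suc 0) - ln (real (Suc 0)) = (1 :: real)" by (simp add: harm_def)
    with decseqD[OF decseq_harm_diff_ln le0[of m]] show ?thesis unfolding m by linarith
  qed
  finally show ?thesis .
qed

section \<open>Tail counts, degree fractions and the degree of the attached vertex\<close>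

context depref_model
begin

definition tail_count :: "nat \<Rightarrow> nat \<Rightarrow> 'w \<Rightarrow> real" where
  "tail_count k n \<omega> = (\<Sum>j=1..n. of_bool (k \<le> vdeg e j n \<omega>))"

lemma tail_count_1: "\<omega> \<in> space M \<Longrightarrow> tail_count 1 n \<omega> = real n"
  using vdeg_pos[of \<omega> _ n] by (simp add: tail_count_def)

lemma tail_count_diff:
  "tail_count k n \<omega> - tail_count (Suc k) n \<omega> = (\<Sum>j=1..n. of_bool (vdeg e j n \<omega> = k))"
  unfolding tail_count_def sum_subtractf[symmetric] by (intro sum.cong) auto

lemma tail_count_antimono: "tail_count (Suc k) n \<omega> \<le> tail_count k n \<omega>"
  unfolding tail_count_def by (intro sum_mono) auto

lemma sum_level_weight:
  "(\<Sum>j=1..n. of_bool (vdeg e j n \<omega> = k) * (w (vdeg e j n \<omega>) / total_weight n \<omega>))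
    = w k * (tail_count k n \<omega> - tail_count (Suc k) n \<omega>) / total_weight n \<omega>"
  unfolding tail_count_diff sum_distrib_left sum_divide_distrib by (intro sum.cong) auto

text \<open>A vertex passes level \<open>k\<close> exactly when it has degree \<open>k\<close> and
  receives the new edge. The arriving vertex has degree 1 and does not count, as
  \<open>Suc k > 1\<close>.\<close>

lemma tail_count_Suc:
  assumes \<omega>: "\<omega> \<in> space M" and k: "1 \<le> k"
  shows "tail_count (Suc k) (Suc n) \<omega> = tail_count (Suc k) n \<omega>
    + w k * (tail_count k n \<omega> - tail_count (Suc k) n \<omega>) / total_weight n \<omega>
    + noise n (\<lambda>j \<omega>. of_bool (vdeg e j n \<omega> = k)) \<omega>"
proof -
  have "tail_count (Suc k) (Suc n) \<omega> = (\<Sum>j=1..n. of_bool (Suc k \<le> vdeg e j (Suc n) \<omega>))"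
    using vdeg_new[OF \<omega>, of "Suc n"] k by (simp add: tail_count_def)
  also have "\<dots> = (\<Sum>j=1..n. of_bool (Suc k \<le> vdeg e j n \<omega>) + of_bool (vdeg e j n \<omega> = k) * attach n j \<omega>)"
  proof (intro sum.cong refl)
    fix j assume "j \<in> {1..n}"
    then have "vdeg e j (Suc n) \<omega> = vdeg e j n \<omega> + of_bool (e (Suc n) \<omega> = {Suc n, j})"
      using \<omega> by (intro vdeg_Suc) auto
    then show "of_bool (Suc k \<le> vdeg e j (Suc n) \<omega>)
        = of_bool (Suc k \<le> vdeg e j n \<omega>) + of_bool (vdeg e j n \<omega> = k) * attach n j \<omega>"
      by (auto simp: attach_def)
  qed
  also have "\<dots> = tail_count (Suc k) n \<omega> + (\<Sum>j=1..n. of_bool (vdeg e j n \<omega> = k) * attach n j \<omega>)"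
    by (simp add: sum.distrib tail_count_def)
  also have "(\<Sum>j=1..n. of_bool (vdeg e j n \<omega> = k) * attach n j \<omega>)
      = (\<Sum>j=1..n. of_bool (vdeg e j n \<omega> = k) * (w (vdeg e j n \<omega>) / total_weight n \<omega>))
        + noise n (\<lambda>j \<omega>. of_bool (vdeg e j n \<omega> = k)) \<omega>"
    unfolding noise_def sum.distrib[symmetric] by (intro sum.cong) (auto simp: algebra_simps)
  finally show ?thesis unfolding sum_level_weight by simp
qed

lemma total_weight_layer_cake:
  assumes \<omega>: "\<omega> \<in> space M" and K: "1 \<le> K"
  shows "w 1 * real n - (\<Sum>k=1..<K. (w k - w (Suc k)) * tail_count (Suc k) n \<omega>)
    = (\<Sum>j=1..n. w (min (vdeg e j n \<omega>) K))"
proof -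
  have "(\<Sum>k=1..<K. (w k - w (Suc k)) * tail_count (Suc k) n \<omega>)
      = (\<Sum>j=1..n. \<Sum>k=1..<K. (w k - w (Suc k)) * of_bool (Suc k \<le> vdeg e j n \<omega>))"
    unfolding tail_count_def sum_distrib_left by (rule sum.swap)
  then have "w 1 * real n - (\<Sum>k=1..<K. (w k - w (Suc k)) * tail_count (Suc k) n \<omega>)
      = (\<Sum>j=1..n. w 1 - (\<Sum>k=1..<K. (w k - w (Suc k)) * of_bool (Suc k \<le> vdeg e j n \<omega>)))"
    by (simp add: sum_subtractf)
  also have "\<dots> = (\<Sum>j=1..n. w (min (vdeg e j n \<omega>) K))"
    using vdeg_pos[OF \<omega>, of _ n] K by (intro sum.cong refl weight_layer_cake) auto
  finally show ?thesis .
qed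

lemma total_weight_le:
  "\<omega> \<in> space M \<Longrightarrow> 1 \<le> K \<Longrightarrow>
    total_weight n \<omega> \<le> w 1 * real n - (\<Sum>k=1..<K. (w k - w (Suc k)) * tail_count (Suc k) n \<omega>)"
  unfolding total_weight_layer_cake unfolding total_weight_def
  using vdeg_pos[of \<omega> _ n] by (intro sum_mono weight_truncation) auto

lemma total_weight_ge:
  assumes \<omega>: "\<omega> \<in> space M" and K: "1 \<le> K"
  shows "w 1 * real n - (\<Sum>k=1..<K. (w k - w (Suc k)) * tail_count (Suc k) n \<omega>)
    \<le> total_weight n \<omega> + w K * real n"
proof -
  have "(\<Sum>j=1..n. w (min (vdeg e j n \<omega>) K)) \<le> (\<Sum>j=1..n. w (vdeg e j n \<omega>) + w K)"
    using vdeg_pos[OF \<omega>, of _ n] K by (intro sum_mono weight_truncation) auto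
  then show ?thesis unfolding total_weight_layer_cake[OF assms]
    by (simp add: sum.distrib total_weight_def mult.commute)
qed

text \<open>Each arrival raises the sum by at most 2, once for each end point of its edge.\<close>

lemma sum_vdeg_le: "\<omega> \<in> space M \<Longrightarrow> (\<Sum>j=1..n. real (vdeg e j n \<omega>)) \<le> 2 * real n"
proof (induction n)
  case 0 then show ?case by simp
next
  case (Suc n)
  have "(\<Sum>j=1..n. real (vdeg e j (Suc n) \<omega>)) = (\<Sum>j=1..n. real (vdeg e j n \<omega>) + attach n j \<omega>)"
    using Suc.prems by (intro sum.cong) (auto simp: vdeg_Suc attach_def)
  also have "\<dots> = (\<Sum>j=1..n. real (vdeg e j n \<omega>)) + (\<Sum>j=1..n. attach n j \<omega>)"
    by (rule sum.distrib)
  also have "(\<Sum>j=1..n. attach n j \<omega>) \<le> 1"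
  proof (cases "1 \<le> n")
    case True
    then obtain i where i: "\<And>g :: nat \<Rightarrow> real. (\<Sum>j=1..n. g j * attach n j \<omega>) = g i"
      using sum_attach[OF Suc.prems True] by metis
    then show ?thesis using i[of "\<lambda>_. 1"] by simp
  qed simp
  finally show ?case using Suc vdeg_new[OF Suc.prems, of "Suc n"] by simp
qed

definition min_rate :: real where "min_rate = w 4 / 2"

lemma min_rate_pos: "0 < min_rate"
  using w_pos[of 4] by (simp add: min_rate_def)

lemma total_weight_linear:
  assumes \<omega>: "\<omega> \<in> space M"
  shows "min_rate * real n \<le> total_weight n \<omega>"
proof -
  have "min_rate * real n = w 4 * (real n - 2 * real n / 4)" by (simp add: min_rate_def)
  also have "\<dots> \<le> w 4 * (real n - (\<Sum>j=1..n. real (vdeg e j n \<omega>)) / 4)"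
    using sum_vdeg_le[OF \<omega>, of n] w_nonneg by (intro mult_left_mono diff_left_mono divide_right_mono) auto
  also have "\<dots> = (\<Sum>j=1..n. w 4 * (1 - real (vdeg e j n \<omega>) / 4))"
    by (simp add: sum_distrib_left[symmetric] sum_subtractf sum_divide_distrib)
  also have "\<dots> \<le> total_weight n \<omega>"
    unfolding total_weight_def using vdeg_pos[OF \<omega>, of _ n] by (intro sum_mono weight_lower_bound) auto
  finally show ?thesis .
qed

text \<open>The noise of level \<open>k\<close> is bounded by 2, so the strong law applies to each
  level. The levels are countable, so one null set serves all of them, and outside it the
  deterministic limit lemma applies path by path.\<close>

lemma AE_total_weight_and_tail_limit:
  "AE \<omega> in M. (\<lambda>n. total_weight n \<omega> / real n) \<longlonglongrightarrow> rate \<alpha> \<delta>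
    \<and> (\<forall>k. (\<lambda>n. tail_count (Suc k) n \<omega> / real n) \<longlonglongrightarrow> surv k (rate \<alpha> \<delta>))"
proof -
  define \<xi> where "\<xi> k n = (if n \<ge> 1 then noise n (\<lambda>j \<omega>. of_bool (vdeg e j n \<omega> = k)) else (\<lambda>_. 0))" for k n
  have "AE \<omega> in M. (\<lambda>n. (\<Sum>m<n. \<xi> k m \<omega>) / real n) \<longlonglongrightarrow> 0" for k
  proof -
    interpret bounded_noise M F "\<xi> k" "\<lambda>_. 2 * 1"
      unfolding \<xi>_def by (rule noise_process) (auto intro: vdeg_fun_adapted)
    show ?thesis by (rule strong_law[where C = 2]) simp
  qed
  then have "AE \<omega> in M. \<forall>k. (\<lambda>n. (\<Sum>m<n. \<xi> k m \<omega>) / real n) \<longlonglongrightarrow> 0"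
    by (simp add: AE_all_countable)
  then show ?thesis
    using AE_space
  proof eventually_elim
    case (elim \<omega>)
    note facts = tail_count_1[OF elim(2)] tail_count_antimono total_weight_pos[OF elim(2)]
    have rec: "tail_count (Suc k) (Suc n) \<omega> = tail_count (Suc k) n \<omega>
        + w k * (tail_count k n \<omega> - tail_count (Suc k) n \<omega>) / total_weight n \<omega> + \<xi> k n \<omega>"
      if "k \<ge> 1" "n \<ge> 1" for k n
      using tail_count_Suc[OF elim(2) that(1), of n] that by (simp add: \<xi>_def)
    have noise0: "(\<lambda>n. (\<Sum>m<n. \<xi> k m \<omega>) / real n) \<longlonglongrightarrow> 0" for k using elim(1) by simp
    note args = facts rec noise0 total_weight_le[OF elim(2)] total_weight_ge[OF elim(2)] min_rate_pos
      total_weight_linear[OF elim(2)]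
    show ?case
    proof (intro conjI allI)
      show "(\<lambda>n. total_weight n \<omega> / real n) \<longlonglongrightarrow> rate \<alpha> \<delta>"
        by (rule weight_and_tail_limit(1)[where T = "\<lambda>k n. tail_count k n \<omega>" and \<xi> = "\<lambda>k n. \<xi> k n \<omega>"
              and ?c0.0 = min_rate]) (rule args; assumption?)+
      show "(\<lambda>n. tail_count (Suc k) n \<omega> / real n) \<longlonglongrightarrow> surv k (rate \<alpha> \<delta>)" for k
        by (rule weight_and_tail_limit(2)[where T = "\<lambda>k n. tail_count k n \<omega>" and \<xi> = "\<lambda>k n. \<xi> k n \<omega>"
              and S = "\<lambda>n. total_weight n \<omega>" and ?c0.0 = min_rate]) (rule args; assumption?)+
    qed
  qed
qed

lemma degree_fraction_tail: "degree_fraction e k n \<omega> = tail_count k n \<omega> / real n - tail_count (Suc k) n \<omega> / real n"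
  unfolding degree_fraction_def tail_count_diff[symmetric] by (simp add: diff_divide_distrib)

lemma AE_degree_fraction_limit:
  assumes k: "1 \<le> k"
  shows "AE \<omega> in M. (\<lambda>n. degree_fraction e k n \<omega>) \<longlonglongrightarrow> surv (k - 1) (rate \<alpha> \<delta>) - surv k (rate \<alpha> \<delta>)"
  using AE_total_weight_and_tail_limit
proof eventually_elim
  case (elim \<omega>)
  obtain l where l: "k = Suc l" using k by (cases k) auto
  show ?case unfolding degree_fraction_tail
    using tendsto_diff[OF conjunct2[OF elim, rule_format, of l] conjunct2[OF elim, rule_format, of k]]
    by (simp add: l)
qed

text \<open>The event is split by the end point \<open>v\<close> of the new edge, and each
  attachment indicator is replaced by its conditional probability; the degree \<open>k\<close> is
  known at time \<open>n\<close>.\<close>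

lemma attach_level_probability:
  assumes n: "1 \<le> n"
  shows "measure M {\<omega> \<in> space M. \<exists>v\<in>{1..n}. e (Suc n) \<omega> = {Suc n, v} \<and> vdeg e v n \<omega> = k}
    = expectation (\<lambda>\<omega>. w k * (tail_count k n \<omega> - tail_count (Suc k) n \<omega>) / total_weight n \<omega>)"
proof -
  let ?B = "{\<omega> \<in> space M. \<exists>v\<in>{1..n}. e (Suc n) \<omega> = {Suc n, v} \<and> vdeg e v n \<omega> = k}"
  let ?I = "\<lambda>j \<omega>. of_bool (vdeg e j n \<omega> = k) :: real"
  let ?p = "\<lambda>j \<omega>. w (vdeg e j n \<omega>) / total_weight n \<omega>"
  have ind: "indicator ?B \<omega> = (\<Sum>j=1..n. ?I j \<omega> * attach n j \<omega>)" if \<omega>: "\<omega> \<in> space M" for \<omega>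
  proof -
    obtain i where i: "i \<in> {1..n}" "e (Suc n) \<omega> = {Suc n, i}"
      "\<And>g :: nat \<Rightarrow> real. (\<Sum>j=1..n. g j * attach n j \<omega>) = g i" using sum_attach[OF \<omega> n] by metis
    have "\<omega> \<in> ?B \<longleftrightarrow> vdeg e i n \<omega> = k" using i(1,2) \<omega> by (auto simp: doubleton_eq_iff)
    then show ?thesis using i(3)[of "\<lambda>j. ?I j \<omega>"] by (simp add: indicator_def)
  qed
  have meas: "?I j \<in> borel_measurable (F n)" for j by (rule vdeg_fun_adapted)
  have measM [measurable]: "?I j \<in> borel_measurable M" for j by (rule vdeg_fun_measurable)
  have i1: "integrable M (\<lambda>\<omega>. ?I j \<omega> * attach n j \<omega>)" for j
    by (rule bounded_integrable[where C = 1]) (measurable, auto simp: attach_def)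
  have i2: "integrable M (\<lambda>\<omega>. ?I j \<omega> * ?p j \<omega>)" if "j \<in> {1..n}" for j
  proof (rule bounded_integrable[where C = 1])
    show "\<bar>?I j \<omega> * ?p j \<omega>\<bar> \<le> 1" if "\<omega> \<in> space M" for \<omega>
      using attach_probability_le_1[OF that \<open>j \<in> {1..n}\<close>] attach_probability_nonneg[OF that, of j n]
      by (cases "vdeg e j n \<omega> = k") auto
  qed measurable
  have "(\<lambda>\<omega>. \<Sum>j=1..n. ?I j \<omega> * attach n j \<omega>) \<in> borel_measurable M" by measurable
  then have "(indicator ?B :: 'w \<Rightarrow> real) \<in> borel_measurable M"
    by (rule measurable_cong[THEN iffD2, rotated]) (rule ind)
  then have B: "?B \<in> sets M" by (auto simp: borel_measurable_indicator_iff Int_absorb2)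
  have "measure M ?B = expectation (indicator ?B)" using B by simp
  also have "\<dots> = expectation (\<lambda>\<omega>. \<Sum>j=1..n. ?I j \<omega> * attach n j \<omega>)"
    by (intro Bochner_Integration.integral_cong refl ind)
  also have "\<dots> = (\<Sum>j=1..n. expectation (\<lambda>\<omega>. ?I j \<omega> * attach n j \<omega>))"
    by (intro Bochner_Integration.integral_sum i1)
  also have "\<dots> = (\<Sum>j=1..n. expectation (\<lambda>\<omega>. ?I j \<omega> * ?p j \<omega>))"
    using n by (intro sum.cong refl expectation_attach[where C = 1] meas) auto
  also have "\<dots> = expectation (\<lambda>\<omega>. \<Sum>j=1..n. ?I j \<omega> * ?p j \<omega>)"
    by (intro Bochner_Integration.integral_sum[symmetric] i2)
  also have "\<dots> = expectation (\<lambda>\<omega>. w k * (tail_count k n \<omega> - tail_count (Suc k) n \<omega>) / total_weight n \<omega>)"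
    unfolding sum_level_weight ..
  finally show ?thesis .
qed

text \<open>The integrand is a conditional probability, hence bounded by 1, and dominated
  convergence applies. Its almost sure limit \<open>w k * (surv (k - 1) r - surv k r) / r\<close> at
  the rate \<open>r\<close> is \<open>surv k r\<close> by the balance equation.\<close>

lemma attach_level_probability_limit:
  assumes k: "1 \<le> k"
  shows "(\<lambda>n. measure M {\<omega> \<in> space M. \<exists>v\<in>{1..n}. e (Suc n) \<omega> = {Suc n, v} \<and> vdeg e v n \<omega> = k})
    \<longlonglongrightarrow> surv k (rate \<alpha> \<delta>)"
proof -
  let ?l = "rate \<alpha> \<delta>"
  obtain l where l: "k = Suc l" using k by (cases k) auto
  let ?q = "\<lambda>n \<omega>. w k * (tail_count k n \<omega> - tail_count (Suc k) n \<omega>) / total_weight n \<omega>"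
  have tc [measurable]: "tail_count k n \<in> borel_measurable M" for k n
    unfolding tail_count_def[abs_def] by (intro borel_measurable_sum vdeg_fun_measurable)
  have lim: "AE \<omega> in M. (\<lambda>n. ?q n \<omega>) \<longlonglongrightarrow> surv k ?l"
    using AE_total_weight_and_tail_limit
  proof eventually_elim
    case (elim \<omega>)
    have "(\<lambda>n. w k * (tail_count (Suc l) n \<omega> / real n - tail_count (Suc k) n \<omega> / real n) / (total_weight n \<omega> / real n))
        \<longlonglongrightarrow> w k * (surv l ?l - surv k ?l) / ?l"
      using elim rate_pos by (intro tendsto_intros) auto
    moreover have "w k * (surv l ?l - surv k ?l) / ?l = surv k ?l"
      using surv_step[of ?l l] rate_pos by (simp add: l field_simps)
    moreover have "\<forall>\<^sub>F n in sequentially.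
        w k * (tail_count (Suc l) n \<omega> / real n - tail_count (Suc k) n \<omega> / real n) / (total_weight n \<omega> / real n) = ?q n \<omega>"
      using eventually_gt_at_top[of 0]
      by eventually_elim (simp add: l diff_divide_distrib[symmetric])
    ultimately show ?case by (auto intro: Lim_transform_eventually)
  qed
  have "(\<lambda>n. expectation (?q n)) \<longlonglongrightarrow> expectation (\<lambda>_. surv k ?l)"
  proof (rule integral_dominated_convergence[where w = "\<lambda>_. 1"])
    show "AE \<omega> in M. norm (?q n \<omega>) \<le> 1" for n
    proof (intro AE_I2)
      fix \<omega> assume \<omega>: "\<omega> \<in> space M"
      have "?q n \<omega> = (\<Sum>j=1..n. of_bool (vdeg e j n \<omega> = k) * (w (vdeg e j n \<omega>) / total_weight n \<omega>))"
        by (rule sum_level_weight[symmetric])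
      moreover have "0 \<le> \<dots>" using attach_probability_nonneg[OF \<omega>] by (intro sum_nonneg mult_nonneg_nonneg) auto
      moreover have "(\<Sum>j=1..n. of_bool (vdeg e j n \<omega> = k) * (w (vdeg e j n \<omega>) / total_weight n \<omega>))
          \<le> (\<Sum>j=1..n. w (vdeg e j n \<omega>) / total_weight n \<omega>)"
        using attach_probability_nonneg[OF \<omega>] by (intro sum_mono) auto
      moreover have "(\<Sum>j=1..n. w (vdeg e j n \<omega>) / total_weight n \<omega>) \<le> 1"
        using sum_attach_probability[OF \<omega>, of n] by (cases "1 \<le> n") auto
      ultimately show "norm (?q n \<omega>) \<le> 1" by simp
    qed
  qed (use lim in measurable)
  then have "(\<lambda>n. expectation (?q n)) \<longlonglongrightarrow> surv k ?l" by (simp add: prob_space)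
  moreover have "\<forall>\<^sub>F n in sequentially. expectation (?q n) =
      measure M {\<omega> \<in> space M. \<exists>v\<in>{1..n}. e (Suc n) \<omega> = {Suc n, v} \<and> vdeg e v n \<omega> = k}"
    using eventually_ge_at_top[of 1] by eventually_elim (simp only: attach_level_probability)
  ultimately show ?thesis by (rule Lim_transform_eventually)
qed

end

section \<open>The degree of a fixed vertex\<close>

context depref_model
begin

text \<open>The reward \<open>f\<close> of the current degree cancels the weight in the attachment
  probability, since \<open>w d * f d = 1\<close>. This leaves the compensator
  \<open>1 / total_weight\<close>, free of the degree.\<close>

definition vertex_noise :: "nat \<Rightarrow> nat \<Rightarrow> 'w \<Rightarrow> real" where
  "vertex_noise i n =
     (if i \<le> n then noise n (\<lambda>j \<omega>. if j = i then f (vdeg e j n \<omega>) else 0) else (\<lambda>_. 0))"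

text \<open>The bound uses only that the degree is at most \<open>n\<close>. It grows with
  \<open>n\<close> and serves integrability and orthogonality; the actual size of the noise is
  estimated by second moments below.\<close>

lemma vertex_noise_process:
  assumes i: "1 \<le> i"
  shows "bounded_noise M F (vertex_noise i) (\<lambda>n. 2 * f n)"
  unfolding vertex_noise_def[abs_def]
proof (rule noise_process)
  fix n j :: nat assume "i \<le> n" "j \<in> {1..n}"
  show "(\<lambda>\<omega>. if j = i then f (vdeg e j n \<omega>) else 0) \<in> borel_measurable (F n)"
    by (cases "j = i") (auto intro: vdeg_fun_adapted)
next
  fix n j :: nat and \<omega> assume a: "i \<le> n" "\<omega> \<in> space M" "j \<in> {1..n}"
  have "f (vdeg e j n \<omega>) \<le> f n"
    using a vdeg_pos[of \<omega> j n] vdeg_le[of j n \<omega>] by (intro f_mono) auto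
  then show "\<bar>if j = i then f (vdeg e j n \<omega>) else 0\<bar> \<le> f n" using f_nonneg by auto
qed (rule f_nonneg)

lemma vertex_noise_eq:
  assumes \<omega>: "\<omega> \<in> space M" and i: "1 \<le> i" "i \<le> n"
  shows "vertex_noise i n \<omega> = f (vdeg e i n \<omega>) * attach n i \<omega> - 1 / total_weight n \<omega>"
proof -
  have "vertex_noise i n \<omega> = (\<Sum>j=1..n. if j = i then
      f (vdeg e i n \<omega>) * (attach n i \<omega> - w (vdeg e i n \<omega>) / total_weight n \<omega>) else 0)"
    unfolding vertex_noise_def noise_def if_P[OF i(2)] by (intro sum.cong) auto
  also have "\<dots> = f (vdeg e i n \<omega>) * attach n i \<omega>
      - (w (vdeg e i n \<omega>) * f (vdeg e i n \<omega>)) / total_weight n \<omega>"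
    using i by (simp add: algebra_simps)
  finally show ?thesis using w_f[OF vdeg_pos[OF \<omega> i]] by simp
qed

text \<open>At time \<open>i\<close> the vertex has degree 1, so its transformed degree starts at 0,
  and the noise before \<open>i\<close> is zero by definition.\<close>

lemma cum_f_vdeg_decomposition:
  assumes \<omega>: "\<omega> \<in> space M" and i: "1 \<le> i" "i \<le> n"
  shows "cum_f (vdeg e i n \<omega>) = (\<Sum>m=i..<n. 1 / total_weight m \<omega>) + (\<Sum>m<n. vertex_noise i m \<omega>)"
  using i(2)
proof (induction n rule: dec_induct)
  case base
  have "(\<Sum>m<i. vertex_noise i m \<omega>) = 0" by (intro sum.neutral) (auto simp: vertex_noise_def)
  then show ?case using vdeg_new[OF \<omega> i(1)] by simp
next
  case (step n)
  have "cum_f (vdeg e i (Suc n) \<omega>) = cum_f (vdeg e i n \<omega>) + f (vdeg e i n \<omega>) * attach n i \<omega>"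
    using vdeg_Suc[OF \<omega> i(1), of n] step vdeg_pos[OF \<omega> i(1), of n] by (auto simp: attach_def cum_f_Suc)
  also have "\<dots> = cum_f (vdeg e i n \<omega>) + 1 / total_weight n \<omega> + vertex_noise i n \<omega>"
    using vertex_noise_eq[OF \<omega> i(1), of n] step by simp
  finally show ?case using step by simp
qed

lemma sum_inverse_total_weight_le:
  assumes \<omega>: "\<omega> \<in> space M" and i: "1 \<le> i" and n: "1 \<le> n" "n \<le> N"
  shows "(\<Sum>m=i..<n. 1 / total_weight m \<omega>) \<le> (1 + ln (real N)) / min_rate"
proof -
  have "(\<Sum>m=i..<n. 1 / total_weight m \<omega>) \<le> (\<Sum>m=i..<n. 1 / real m / min_rate)"
  proof (intro sum_mono)
    fix m assume "m \<in> {i..<n}"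
    then have "0 < min_rate * real m" using i min_rate_pos by simp
    then show "1 / total_weight m \<omega> \<le> 1 / real m / min_rate"
      using total_weight_linear[OF \<omega>, of m] by (simp add: frac_le mult.commute)
  qed
  also have "\<dots> \<le> (\<Sum>m=1..<n. 1 / real m / min_rate)"
    using i min_rate_pos by (intro sum_mono2) auto
  also have "\<dots> = (\<Sum>m=1..<n. 1 / real m) / min_rate" by (simp add: sum_divide_distrib)
  also have "\<dots> \<le> (1 + ln (real n)) / min_rate"
    using min_rate_pos n by (intro divide_right_mono sum_inverse_le_ln) auto
  also have "\<dots> \<le> (1 + ln (real N)) / min_rate"
    using min_rate_pos n by (intro divide_right_mono) auto
  finally show ?thesis .
qed

lemma vdeg_fun_integrable: "integrable M (\<lambda>\<omega>. g (vdeg e j n \<omega>) :: real)"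
proof (rule bounded_integrable[where C = "\<Sum>d\<le>n. \<bar>g d\<bar>"])
  show "\<bar>g (vdeg e j n \<omega>)\<bar> \<le> (\<Sum>d\<le>n. \<bar>g d\<bar>)" for \<omega>
    using vdeg_le[of j n \<omega>] by (intro member_le_sum[where f = "\<lambda>d. \<bar>g d\<bar>"]) auto
qed measurable

text \<open>The noise has mean zero, and the linear lower bound on the weight turns the compensator
  into a harmonic sum. This crude bound of order \<open>ln N\<close> feeds the variance
  estimate.\<close>

lemma expectation_cum_f_le:
  assumes i: "1 \<le> i" and n: "i \<le> n" "n \<le> N"
  shows "expectation (\<lambda>\<omega>. cum_f (vdeg e i n \<omega>)) \<le> (1 + ln (real N)) / min_rate"
proof -
  interpret V: bounded_noise M F "vertex_noise i" "\<lambda>n. 2 * f n" by (rule vertex_noise_process[OF i])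
  have intX: "integrable M (vertex_noise i m)" for m
    using V.bounded by (intro bounded_integrable[where C = "2 * f m"]) auto
  have zero: "expectation (\<lambda>\<omega>. \<Sum>m<n. vertex_noise i m \<omega>) = 0"
  proof -
    have "expectation (vertex_noise i m) = 0" for m
      using V.orthogonal[of "\<lambda>_. 1" m 1] by simp
    then show ?thesis using intX by simp
  qed
  have intc: "integrable M (\<lambda>\<omega>. cum_f (vdeg e i n \<omega>))" by (rule vdeg_fun_integrable)
  have "expectation (\<lambda>\<omega>. cum_f (vdeg e i n \<omega>))
      = expectation (\<lambda>\<omega>. cum_f (vdeg e i n \<omega>) - (\<Sum>m<n. vertex_noise i m \<omega>))"
    using zero intX intc by (subst Bochner_Integration.integral_diff) auto
  also have "\<dots> \<le> expectation (\<lambda>_. (1 + ln (real N)) / min_rate)"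
  proof (intro integral_mono Bochner_Integration.integrable_diff intc Bochner_Integration.integrable_sum intX)
    fix \<omega> assume \<omega>: "\<omega> \<in> space M"
    show "cum_f (vdeg e i n \<omega>) - (\<Sum>m<n. vertex_noise i m \<omega>) \<le> (1 + ln (real N)) / min_rate"
      using cum_f_vdeg_decomposition[OF \<omega> i n(1)] sum_inverse_total_weight_le[OF \<omega> i, of n N] i n by simp
  qed simp
  finally show ?thesis by (simp add: prob_space)
qed

text \<open>For an indicator with conditional probability \<open>p\<close>, the centred square is at
  most the indicator plus \<open>p\<close>. In the resulting mean of
  \<open>2 * (f d)\<^sup>2 * p\<close> one factor \<open>f d\<close> cancels against the weight in
  \<open>p\<close>.\<close>

lemma expectation_vertex_noise_square_le:
  assumes i: "1 \<le> i" and n: "i \<le> n"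
  shows "expectation (\<lambda>\<omega>. (vertex_noise i n \<omega>)\<^sup>2)
    \<le> 2 / (min_rate * real n) * expectation (\<lambda>\<omega>. f (vdeg e i n \<omega>))"
proof -
  interpret V: bounded_noise M F "vertex_noise i" "\<lambda>n. 2 * f n" by (rule vertex_noise_process[OF i])
  let ?D = "\<lambda>\<omega>. vdeg e i n \<omega>"
  let ?p = "\<lambda>\<omega>. w (?D \<omega>) / total_weight n \<omega>"
  have in_n: "i \<in> {1..n}" using i n by auto
  have n0: "0 < min_rate * real n" using min_rate_pos i n by simp
  have fb: "\<bar>(f (?D \<omega>))\<^sup>2\<bar> \<le> (f n)\<^sup>2" if "\<omega> \<in> space M" for \<omega>
    using vdeg_pos[OF that i n] vdeg_le[of i n \<omega>] f_nonneg by (auto intro!: power_mono f_mono)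
  have i1: "integrable M (\<lambda>\<omega>. (f (?D \<omega>))\<^sup>2 * attach n i \<omega>)"
  proof (rule bounded_integrable)
    show "\<bar>(f (?D \<omega>))\<^sup>2 * attach n i \<omega>\<bar> \<le> (f n)\<^sup>2" if "\<omega> \<in> space M" for \<omega>
      using fb[OF that] by (auto simp: attach_def)
  qed measurable
  have i2: "integrable M (\<lambda>\<omega>. (f (?D \<omega>))\<^sup>2 * ?p \<omega>)"
  proof (rule bounded_integrable)
    show "\<bar>(f (?D \<omega>))\<^sup>2 * ?p \<omega>\<bar> \<le> (f n)\<^sup>2 * 1" if "\<omega> \<in> space M" for \<omega>
      unfolding abs_mult[of _ "?p \<omega>"]
      using fb[OF that] attach_probability_le_1[OF that in_n] attach_probability_nonneg[OF that, of i n]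
      by (intro mult_mono) auto
  qed measurable
  have "expectation (\<lambda>\<omega>. (vertex_noise i n \<omega>)\<^sup>2)
      \<le> expectation (\<lambda>\<omega>. (f (?D \<omega>))\<^sup>2 * attach n i \<omega> + (f (?D \<omega>))\<^sup>2 * ?p \<omega>)"
  proof (intro integral_mono V.integrable_square Bochner_Integration.integrable_add i1 i2)
    fix \<omega> assume \<omega>: "\<omega> \<in> space M"
    define p where "p = ?p \<omega>"
    have p: "0 \<le> p" "p \<le> 1"
      using attach_probability_le_1[OF \<omega> in_n] attach_probability_nonneg[OF \<omega>, of i n] by (auto simp: p_def)
    have "f (?D \<omega>) * p = 1 / total_weight n \<omega>"
      using w_f[OF vdeg_pos[OF \<omega> i n]] by (simp add: p_def mult.commute)
    then have "vertex_noise i n \<omega> = f (?D \<omega>) * (attach n i \<omega> - p)"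
      using vertex_noise_eq[OF \<omega> i n] by (simp add: right_diff_distrib)
    then have "(vertex_noise i n \<omega>)\<^sup>2 = (f (?D \<omega>))\<^sup>2 * (attach n i \<omega> - p)\<^sup>2"
      by (simp add: power_mult_distrib)
    also have "(attach n i \<omega> - p)\<^sup>2 \<le> attach n i \<omega> + p"
    proof -
      have "p\<^sup>2 \<le> p" "(1 - p)\<^sup>2 \<le> 1"
        using p by (simp_all add: power2_eq_square mult_left_le_one_le mult_le_one)
      then show ?thesis using p by (auto simp: attach_def)
    qed
    finally show "(vertex_noise i n \<omega>)\<^sup>2 \<le> (f (?D \<omega>))\<^sup>2 * attach n i \<omega> + (f (?D \<omega>))\<^sup>2 * ?p \<omega>"
      unfolding p_def by (simp only: distrib_left mult_left_mono zero_le_power2)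
  qed
  also have "\<dots> = 2 * expectation (\<lambda>\<omega>. (f (?D \<omega>))\<^sup>2 * ?p \<omega>)"
    using expectation_attach[OF _ in_n vdeg_fun_adapted[of "\<lambda>d. (f d)\<^sup>2" i n] fb] i n i1 i2 by simp
  also have "\<dots> \<le> 2 * expectation (\<lambda>\<omega>. 1 / (min_rate * real n) * f (?D \<omega>))"
  proof (intro mult_left_mono integral_mono i2 integrable_mult_right vdeg_fun_integrable)
    fix \<omega> assume \<omega>: "\<omega> \<in> space M"
    have "(f (?D \<omega>))\<^sup>2 * ?p \<omega> = (w (?D \<omega>) * f (?D \<omega>)) * f (?D \<omega>) / total_weight n \<omega>"
      by (simp add: power2_eq_square)
    also have "\<dots> = f (?D \<omega>) / total_weight n \<omega>" using w_f[OF vdeg_pos[OF \<omega> i n]] by simp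
    also have "\<dots> \<le> f (?D \<omega>) / (min_rate * real n)"
      using total_weight_linear[OF \<omega>, of n] n0 total_weight_pos[OF \<omega>, of n] f_nonneg i n
      by (intro divide_left_mono mult_pos_pos[OF _ n0]) auto
    finally show "(f (?D \<omega>))\<^sup>2 * ?p \<omega> \<le> 1 / (min_rate * real n) * f (?D \<omega>)" by simp
  qed simp
  finally show ?thesis by simp
qed

text \<open>The quadratic bound on \<open>f\<close> turns the mean of \<open>cum_f\<close>, of order
  \<open>ln n\<close>, into a mean of \<open>f\<close> of order \<open>sqrt (ln n)\<close>. Summing
  the variances, of order \<open>sqrt (ln n) / m\<close>, contributes another factor
  \<open>ln n\<close>.\<close>

lemma vertex_noise_second_moment:
  assumes i: "1 \<le> i"
  obtains C where "0 \<le> C" "\<And>n. 1 \<le> n \<Longrightarrow>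
    expectation (\<lambda>\<omega>. (\<Sum>m<n. vertex_noise i m \<omega>)\<^sup>2) \<le> C * ((1 + ln (real n)) * sqrt (1 + ln (real n)))"
proof -
  interpret V: bounded_noise M F "vertex_noise i" "\<lambda>n. 2 * f n" by (rule vertex_noise_process[OF i])
  obtain C1 where C1: "0 < C1" "\<And>d. 1 \<le> d \<Longrightarrow> (f d)\<^sup>2 \<le> C1 * (1 + cum_f d)" using f_square_le by blast
  define C2 where "C2 = C1 * (1 + 1 / min_rate) + 1"
  have C2: "C2 \<ge> 0" using C1 min_rate_pos by (simp add: C2_def)
  have Ef: "expectation (\<lambda>\<omega>. f (vdeg e i m \<omega>)) \<le> C2 * sqrt (1 + ln (real n))"
    if m: "i \<le> m" "m \<le> n" for m n
  proof -
    define L where "L = 1 + ln (real n)"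
    have L: "1 \<le> L" using m i by (simp add: L_def)
    \<comment> \<open>The threshold in the inequality
      \<open>x \<le> x\<^sup>2 / \<theta> + \<theta>\<close>, used in place of Cauchy-Schwarz: the
      choice \<open>sqrt L\<close> makes both terms of the same order in the mean.\<close>
    define \<theta> where "\<theta> = sqrt L"
    have \<theta>: "0 < \<theta>" "\<theta>\<^sup>2 = L" using L by (auto simp: \<theta>_def)
    have "expectation (\<lambda>\<omega>. f (vdeg e i m \<omega>))
        \<le> expectation (\<lambda>\<omega>. C1 / \<theta> * (1 + cum_f (vdeg e i m \<omega>)) + \<theta>)"
    proof (intro integral_mono vdeg_fun_integrable)
      fix \<omega> assume \<omega>: "\<omega> \<in> space M"
      let ?f = "f (vdeg e i m \<omega>)"
      have "?f \<le> ?f\<^sup>2 / \<theta> + \<theta>"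
      proof (cases "?f \<le> \<theta>")
        case True
        then show ?thesis using \<theta> by (simp add: add_increasing)
      next
        case False
        then have "?f * \<theta> \<le> ?f * ?f" using f_nonneg by (intro mult_left_mono) auto
        then have "?f \<le> ?f\<^sup>2 / \<theta>" using \<theta> by (simp add: field_simps power2_eq_square)
        then show ?thesis using \<theta> by simp
      qed
      also have "?f\<^sup>2 / \<theta> \<le> C1 * (1 + cum_f (vdeg e i m \<omega>)) / \<theta>"
        using C1(2)[OF vdeg_pos[OF \<omega> i m(1)]] \<theta> by (intro divide_right_mono) auto
      finally show "?f \<le> C1 / \<theta> * (1 + cum_f (vdeg e i m \<omega>)) + \<theta>" by simp
    qed
    also have "\<dots> = C1 / \<theta> * (1 + expectation (\<lambda>\<omega>. cum_f (vdeg e i m \<omega>))) + \<theta>"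
      using vdeg_fun_integrable[of cum_f i m] by (simp add: prob_space)
    also have "\<dots> \<le> C1 / \<theta> * (L + L / min_rate) + \<theta>"
      using expectation_cum_f_le[OF i m] L C1 \<theta>
      by (intro add_right_mono mult_left_mono add_mono) (auto simp: L_def)
    also have "\<dots> = C1 * (1 + 1 / min_rate) * (\<theta>\<^sup>2 / \<theta>) + \<theta>"
      unfolding \<theta>(2) using min_rate_pos \<theta>(1) by (simp add: field_simps)
    also have "\<theta>\<^sup>2 / \<theta> = \<theta>" using \<theta>(1) by (simp add: power2_eq_square)
    also have "C1 * (1 + 1 / min_rate) * \<theta> + \<theta> = C2 * \<theta>" using \<theta>(1) by (simp add: C2_def algebra_simps)
    finally show ?thesis by (simp add: \<theta>_def L_def)
  qed
  show ?thesis
  proof (rule that)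
    show "0 \<le> 2 * C2 / min_rate" using C2 min_rate_pos by simp
    fix n :: nat assume n: "1 \<le> n"
    define L where "L = 1 + ln (real n)"
    have L: "1 \<le> L" using n by (simp add: L_def)
    have summand: "expectation (\<lambda>\<omega>. (vertex_noise i m \<omega>)\<^sup>2) \<le> 2 * C2 / min_rate * sqrt L * (1 / real m)"
      if m: "m \<in> {1..<n}" for m
    proof (cases "i \<le> m")
      case True
      have "expectation (\<lambda>\<omega>. (vertex_noise i m \<omega>)\<^sup>2)
          \<le> 2 / (min_rate * real m) * expectation (\<lambda>\<omega>. f (vdeg e i m \<omega>))"
        by (rule expectation_vertex_noise_square_le[OF i True])
      also have "\<dots> \<le> 2 / (min_rate * real m) * (C2 * sqrt L)"
        unfolding L_def using m min_rate_pos by (intro mult_left_mono Ef[OF True]) auto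
      finally show ?thesis by (simp add: field_simps)
    next
      case False
      then show ?thesis using C2 L min_rate_pos by (simp add: vertex_noise_def)
    qed
    have "expectation (\<lambda>\<omega>. (\<Sum>m<n. vertex_noise i m \<omega>)\<^sup>2) = (\<Sum>m<n. expectation (\<lambda>\<omega>. (vertex_noise i m \<omega>)\<^sup>2))"
      by (rule V.second_moment)
    also have "\<dots> = (\<Sum>m=1..<n. expectation (\<lambda>\<omega>. (vertex_noise i m \<omega>)\<^sup>2))"
    proof (rule sum.mono_neutral_right)
      show "\<forall>m\<in>{..<n} - {1..<n}. expectation (\<lambda>\<omega>. (vertex_noise i m \<omega>)\<^sup>2) = 0"
        using i by (auto simp: vertex_noise_def)
    qed auto
    also have "\<dots> \<le> (\<Sum>m=1..<n. 2 * C2 / min_rate * sqrt L * (1 / real m))"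
      by (intro sum_mono summand)
    also have "\<dots> = 2 * C2 / min_rate * sqrt L * (\<Sum>m=1..<n. 1 / real m)"
      by (rule sum_distrib_left[symmetric])
    also have "\<dots> \<le> 2 * C2 / min_rate * sqrt L * L"
      unfolding L_def using C2 min_rate_pos L by (intro mult_left_mono sum_inverse_le_ln n) (auto simp: L_def)
    finally show "expectation (\<lambda>\<omega>. (\<Sum>m<n. vertex_noise i m \<omega>)\<^sup>2)
        \<le> 2 * C2 / min_rate * ((1 + ln (real n)) * sqrt (1 + ln (real n)))"
      by (simp add: L_def mult_ac)
  qed
qed

text \<open>Along \<open>n = 2 ^ (m + 1) ^ 4\<close> the second moments of the noise divided by \<open>ln n\<close> are of order
  \<open>1 / m\<^sup>2\<close>.\<close>

definition sparse_time :: "nat \<Rightarrow> nat" where "sparse_time m = 2 ^ (Suc m ^ 4)"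

lemma ln_sparse_time: "ln (real (sparse_time m)) = real (Suc m) ^ 4 * ln 2"
  unfolding sparse_time_def by (simp add: ln_realpow del: of_nat_Suc)

lemma strict_mono_sparse_time: "strict_mono sparse_time"
  unfolding strict_mono_def sparse_time_def by (auto intro!: power_strict_mono)

lemma vertex_noise_sparse_limit:
  assumes i: "1 \<le> i"
  shows "AE \<omega> in M. (\<lambda>m. (\<Sum>k<sparse_time m. vertex_noise i k \<omega>) / ln (real (sparse_time m))) \<longlonglongrightarrow> 0"
proof -
  interpret V: bounded_noise M F "vertex_noise i" "\<lambda>n. 2 * f n" by (rule vertex_noise_process[OF i])
  obtain C where C: "0 \<le> C" "\<And>n. 1 \<le> n \<Longrightarrow>
    expectation (\<lambda>\<omega>. (\<Sum>m<n. vertex_noise i m \<omega>)\<^sup>2) \<le> C * ((1 + ln (real n)) * sqrt (1 + ln (real n)))"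
    using vertex_noise_second_moment[OF i] by blast
  let ?Y = "\<lambda>m \<omega>. (\<Sum>k<sparse_time m. vertex_noise i k \<omega>)"
  let ?l = "\<lambda>m. ln (real (sparse_time m))"
  have bound: "expectation (\<lambda>\<omega>. (?Y m \<omega> / ?l m)\<^sup>2) \<le> 4 * C / (ln 2)\<^sup>2 * (1 / (real (Suc m))\<^sup>2)" for m
  proof -
    define x where "x = real (Suc m)"
    have x: "x \<ge> 1" by (simp add: x_def)
    have x4: "1 \<le> x ^ 4" using x by simp
    have "x ^ 4 * ln 2 \<le> x ^ 4 * 1" using ln_2_less_1 by (intro mult_left_mono) auto
    then have L: "1 + ?l m \<le> 2 * x ^ 4" "0 \<le> ?l m" unfolding ln_sparse_time x_def[symmetric] using x4 by auto
    have "sqrt (1 + ?l m) \<le> sqrt ((2 * x\<^sup>2)\<^sup>2)"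
    proof (rule real_sqrt_le_mono)
      have "(2 * x\<^sup>2)\<^sup>2 = 4 * x ^ 4" by (simp add: power_mult_distrib power_mult[symmetric])
      then show "1 + ?l m \<le> (2 * x\<^sup>2)\<^sup>2" using L x4 by linarith
    qed
    then have sq: "sqrt (1 + ?l m) \<le> 2 * x\<^sup>2"
      unfolding real_sqrt_abs by simp
    have "expectation (\<lambda>\<omega>. (?Y m \<omega> / ?l m)\<^sup>2) = expectation (\<lambda>\<omega>. (?Y m \<omega>)\<^sup>2) / (?l m)\<^sup>2"
      by (simp only: power_divide integral_divide_zero)
    also have "\<dots> \<le> C * ((1 + ?l m) * sqrt (1 + ?l m)) / (?l m)\<^sup>2"
      by (intro divide_right_mono C(2)) (auto simp: sparse_time_def)
    also have "\<dots> \<le> C * ((2 * x ^ 4) * (2 * x\<^sup>2)) / (?l m)\<^sup>2"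
      using C(1) L sq by (intro divide_right_mono mult_left_mono mult_mono) auto
    also have "\<dots> = C * ((2 * x ^ 4) * (2 * x\<^sup>2)) / (x ^ 4 * ln 2)\<^sup>2"
      by (simp only: ln_sparse_time x_def)
    also have "\<dots> = 4 * C / (ln 2)\<^sup>2 * (1 / x\<^sup>2)"
    proof -
      have "(x ^ 4)\<^sup>2 = x ^ 4 * x\<^sup>2 * x\<^sup>2" by (simp add: power_add[symmetric] power_mult[symmetric])
      then show ?thesis using x by (simp add: power_mult_distrib field_simps)
    qed
    finally show ?thesis by (simp add: x_def)
  qed
  show ?thesis
  proof (rule AE_tendsto_0_of_summable_second_moments)
    show "integrable M (\<lambda>\<omega>. (?Y m \<omega> / ?l m)\<^sup>2)" for m
      unfolding power_divide by (intro integrable_divide_zero impI V.integrable_partial_sum_square)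
    have "summable (\<lambda>m. 4 * C / (ln 2)\<^sup>2 * (1 / (real (Suc m))\<^sup>2))"
      using summable_Suc_iff[of "\<lambda>n. 1 / (real n)\<^sup>2"] inverse_power_summable[of 2, where 'a = real]
      by (intro summable_mult) (simp add: inverse_eq_divide)
    then show "summable (\<lambda>m. expectation (\<lambda>\<omega>. (?Y m \<omega> / ?l m)\<^sup>2))"
      by (rule summable_comparison_test'[where N = 0]) (use bound in \<open>simp add: integral_nonneg_AE\<close>)
  qed
qed

text \<open>The compensator is a logarithmic average of \<open>m / S m\<close>. The noise is known
  to be negligible only along the sparse times; the transformed degree is monotone, which carries
  the limit to all times.\<close>

lemma cum_f_vdeg_limit:
  assumes i: "1 \<le> i"
  shows "AE \<omega> in M. (\<lambda>n. cum_f (vdeg e i n \<omega>) / ln (real n)) \<longlonglongrightarrow> 1 / rate \<alpha> \<delta>"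
  using AE_total_weight_and_tail_limit vertex_noise_sparse_limit[OF i] AE_space
proof eventually_elim
  case (elim \<omega>)
  have "(\<lambda>n. 1 / (total_weight n \<omega> / real n)) \<longlonglongrightarrow> 1 / rate \<alpha> \<delta>"
    using elim(1) rate_pos by (intro tendsto_intros) auto
  then have drift: "(\<lambda>n. (\<Sum>m=i..<n. 1 / (total_weight m \<omega> / real m) / real m) / ln (real n)) \<longlonglongrightarrow> 1 / rate \<alpha> \<delta>"
    by (rule log_weighted_average)
  have drift_eq: "(\<Sum>m=i..<n. 1 / (total_weight m \<omega> / real m) / real m) = (\<Sum>m=i..<n. 1 / total_weight m \<omega>)" for n
    using i by (intro sum.cong) auto
  have sub: "(\<lambda>m. cum_f (vdeg e i (sparse_time m) \<omega>) / ln (real (sparse_time m))) \<longlonglongrightarrow> 1 / rate \<alpha> \<delta>"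
  proof -
    have "(\<lambda>m. (\<Sum>k=i..<sparse_time m. 1 / total_weight k \<omega>) / ln (real (sparse_time m))
        + (\<Sum>k<sparse_time m. vertex_noise i k \<omega>) / ln (real (sparse_time m))) \<longlonglongrightarrow> 1 / rate \<alpha> \<delta> + 0"
      using filterlim_compose[OF drift[unfolded drift_eq] filterlim_subseq[OF strict_mono_sparse_time]] elim(2)
      by (intro tendsto_add) 
    moreover have "\<forall>\<^sub>F m in sequentially. (\<Sum>k=i..<sparse_time m. 1 / total_weight k \<omega>) / ln (real (sparse_time m))
        + (\<Sum>k<sparse_time m. vertex_noise i k \<omega>) / ln (real (sparse_time m))
        = cum_f (vdeg e i (sparse_time m) \<omega>) / ln (real (sparse_time m))"
      using eventually_ge_at_top[of i]
    proof eventually_elim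
      case (elim m)
      then have "i \<le> sparse_time m" using seq_suble[OF strict_mono_sparse_time, of m] by linarith
      then show ?case
        using cum_f_vdeg_decomposition[OF \<open>\<omega> \<in> space M\<close> i] by (simp add: add_divide_distrib)
    qed
    ultimately show ?thesis by (auto intro: Lim_transform_eventually)
  qed
  show ?case
  proof (rule tendsto_sandwich_subseq[OF _ _ _ strict_mono_sparse_time _ _ sub])
    show "mono (\<lambda>n. cum_f (vdeg e i n \<omega>))"
      by (intro monoI cum_f_mono) (auto simp: vdeg_def intro!: card_mono)
    show "mono (\<lambda>n. ln (real n))"
    proof (rule monoI)
      fix m n :: nat assume "m \<le> n"
      then show "ln (real m) \<le> ln (real n)" by (cases "m = 0"; cases "n = 0") auto
    qed
    show "0 \<le> cum_f (vdeg e i 0 \<omega>)" by (rule cum_f_nonneg)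
    show "0 < ln (real (sparse_time m))" for m unfolding ln_sparse_time by simp
    \<comment> \<open>The sparse times are still dense on the logarithmic scale: \<open>ln\<close>
      grows like a fourth power of the index, so consecutive logarithms have ratio tending to
      1.\<close>
    have "(\<lambda>m. (1 + 1 / real (Suc m)) ^ 4) \<longlonglongrightarrow> (1 + 0) ^ 4"
      by (intro tendsto_intros LIMSEQ_Suc[OF lim_1_over_n])
    moreover have "(1 + 1 / real (Suc m)) ^ 4 = ln (real (sparse_time (Suc m))) / ln (real (sparse_time m))" for m
    proof -
      have "1 + 1 / real (Suc m) = real (Suc (Suc m)) / real (Suc m)" by (simp add: field_simps)
      then show ?thesis unfolding ln_sparse_time by (simp add: power_divide del: of_nat_Suc)
    qed
    ultimately show "(\<lambda>m. ln (real (sparse_time (Suc m))) / ln (real (sparse_time m))) \<longlonglongrightarrow> 1" by simp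
  qed
qed

text \<open>Since \<open>cum_f\<close> of the degree grows like \<open>ln n\<close>, the degree
  itself tends to infinity. Only then may the asymptotics
  \<open>cum_f d ~ d powr (1 + \<alpha>) / (1 + \<alpha>)\<close> be evaluated at the degree and
  inverted.\<close>

lemma vdeg_limit:
  assumes i: "1 \<le> i"
  shows "AE \<omega> in M. (\<lambda>n. real (vdeg e i n \<omega>) / ln (real n) powr (1 / (1 + \<alpha>)))
    \<longlonglongrightarrow> ((1 + \<alpha>) / rate \<alpha> \<delta>) powr (1 / (1 + \<alpha>))"
  using cum_f_vdeg_limit[OF i]
proof eventually_elim
  case (elim \<omega>)
  let ?D = "\<lambda>n. vdeg e i n \<omega>"
  have lninf: "filterlim (\<lambda>n. ln (real n)) at_top sequentially"
    by (rule filterlim_compose[OF ln_at_top filterlim_real_sequentially])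
  have "filterlim (\<lambda>n. cum_f (?D n) / ln (real n) * ln (real n)) at_top sequentially"
    using rate_pos by (intro filterlim_tendsto_pos_mult_at_top[OF elim _ lninf]) auto
  then have Dinf: "filterlim ?D at_top sequentially"
    unfolding filterlim_at_top
  proof (intro allI)
    fix Z
    assume a: "\<forall>Z. \<forall>\<^sub>F n in sequentially. Z \<le> cum_f (?D n) / ln (real n) * ln (real n)"
    show "\<forall>\<^sub>F n in sequentially. Z \<le> ?D n"
      using a[rule_format, of "cum_f Z + 1"] eventually_gt_at_top[of 1]
    proof eventually_elim
      case (elim n)
      then have "cum_f Z < cum_f (?D n)" by simp
      then show ?case using cum_f_mono[of "?D n" Z] by linarith
    qed
  qed
  have "(\<lambda>n. (1 + \<alpha>) * (cum_f (?D n) / ln (real n)) / ((1 + \<alpha>) * cum_f (?D n) / real (?D n) powr (1 + \<alpha>)))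
      \<longlonglongrightarrow> (1 + \<alpha>) * (1 / rate \<alpha> \<delta>) / 1"
    by (intro tendsto_intros elim filterlim_compose[OF cum_f_asymptotic Dinf]) auto
  moreover have "\<forall>\<^sub>F n in sequentially.
      (1 + \<alpha>) * (cum_f (?D n) / ln (real n)) / ((1 + \<alpha>) * cum_f (?D n) / real (?D n) powr (1 + \<alpha>))
      = real (?D n) powr (1 + \<alpha>) / ln (real n)"
    using filterlim_at_top[THEN iffD1, OF Dinf, rule_format, of 2]
  proof eventually_elim
    case (elim n)
    \<comment> \<open>\<open>cum_f\<close> vanishes at degree 1, so it can be cancelled only from
      degree 2 on.\<close>
    have "cum_f (Suc (Suc 0)) > 0" using f_pos[of 1] by (simp add: cum_f_Suc)
    then have "cum_f (?D n) > 0" using cum_f_mono[of "Suc (Suc 0)" "?D n"] elim by simp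
    then show ?case using alpha_pos by simp
  qed
  ultimately have "(\<lambda>n. real (?D n) powr (1 + \<alpha>) / ln (real n)) \<longlonglongrightarrow> (1 + \<alpha>) / rate \<alpha> \<delta>"
    by (auto intro: Lim_transform_eventually)
  then have "(\<lambda>n. (real (?D n) powr (1 + \<alpha>) / ln (real n)) powr (1 / (1 + \<alpha>)))
      \<longlonglongrightarrow> ((1 + \<alpha>) / rate \<alpha> \<delta>) powr (1 / (1 + \<alpha>))"
    using alpha_pos rate_pos by (intro tendsto_powr[OF _ tendsto_const]) auto
  moreover have "\<forall>\<^sub>F n in sequentially. (real (?D n) powr (1 + \<alpha>) / ln (real n)) powr (1 / (1 + \<alpha>))
      = real (?D n) / ln (real n) powr (1 / (1 + \<alpha>))"
    using eventually_gt_at_top[of 1]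
    by eventually_elim (use alpha_pos in \<open>simp add: powr_divide powr_powr\<close>)
  ultimately show ?case by (rule Lim_transform_eventually)
qed

end

text \<open>Uniqueness of the root belongs to the conclusion because \<open>rate\<close> is a
  definite description. The third limit concerns the random vertex \<open>v\<close> that receives
  the new edge: for one fixed vertex the degree tends to infinity almost surely, and the probability
  of seeing degree \<open>k\<close> there tends to 0. The product runs up to \<open>k\<close>, so
  the limits over \<open>k \<ge> 1\<close> sum to \<open>char_sum\<close> at the rate, which is
  1.\<close>

theorem theorem2p2:
  fixes M :: "'w measure" and e :: "nat \<Rightarrow> 'w \<Rightarrow> nat set" and \<alpha> \<delta> :: real and i :: nat
  assumes "0 < \<alpha>" and "\<alpha> \<le> 1" and "\<delta> > -1"
    and "inverse_power_depref_attachment M \<alpha> \<delta> e"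
    and "i \<ge> 1"
  shows "(\<exists>!r. is_rate \<alpha> \<delta> r) \<and>
    (AE \<omega> in M.
      (\<lambda>n. real (vdeg e i n \<omega>) / ln (real n) powr (1 / (1 + \<alpha>)))
        \<longlonglongrightarrow> ((1 + \<alpha>) / rate \<alpha> \<delta>) powr (1 / (1 + \<alpha>))) \<and>
    (\<forall>k\<ge>1. AE \<omega> in M.
      (\<lambda>n. degree_fraction e k n \<omega>)
        \<longlonglongrightarrow> ((\<delta> + real k) powr \<alpha> * rate \<alpha> \<delta>) / ((\<delta> + real k) powr \<alpha> * rate \<alpha> \<delta> + 1)
             * (\<Prod>j=1..<k. 1 / ((\<delta> + real j) powr \<alpha> * rate \<alpha> \<delta> + 1))) \<and>
    (\<forall>k\<ge>1.
      (\<lambda>n. measure M {\<omega> \<in> space M.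
              \<exists>v\<in>{1..n}. e (Suc n) \<omega> = {Suc n, v} \<and> vdeg e v n \<omega> = k})
        \<longlonglongrightarrow> (\<Prod>j=1..k. 1 / ((\<delta> + real j) powr \<alpha> * rate \<alpha> \<delta> + 1)))"
proof -
  interpret depref_params \<alpha> \<delta> using assms by unfold_locales auto
  interpret prob_space M using assms by (simp add: inverse_power_depref_attachment_def)
  interpret depref_model \<alpha> \<delta> M e using assms by unfold_locales
  let ?l = "rate \<alpha> \<delta>"
  have prod: "(\<Prod>j=1..k. 1 / ((\<delta> + real j) powr \<alpha> * ?l + 1)) = surv k ?l" for k
    by (simp add: surv_def f_def)
  have level: "(\<delta> + real k) powr \<alpha> * ?l / ((\<delta> + real k) powr \<alpha> * ?l + 1)
      * (\<Prod>j=1..<k. 1 / ((\<delta> + real j) powr \<alpha> * ?l + 1)) = surv (k - 1) ?l - surv k ?l" if "1 \<le> k" for k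
  proof -
    obtain l where l: "k = Suc l" using \<open>1 \<le> k\<close> by (cases k) auto
    have pos: "f k * ?l + 1 > 0" using f_nonneg[of k] rate_pos by (simp add: add_nonneg_pos)
    have "{1..<k} = {1..l}" by (auto simp: l)
    then have "(\<Prod>j=1..<k. 1 / ((\<delta> + real j) powr \<alpha> * ?l + 1)) = surv l ?l" by (simp only: prod)
    moreover have "f k * ?l / (f k * ?l + 1) * surv l ?l = surv l ?l - surv l ?l / (f k * ?l + 1)"
      using pos by (simp add: divide_simps) (simp add: algebra_simps)
    moreover have "surv k ?l = surv l ?l / (f k * ?l + 1)" by (simp add: l surv_Suc)
    ultimately show ?thesis unfolding f_def[symmetric] by (simp add: l)
  qed
  show ?thesis
  proof (intro conjI allI impI)
    show "\<exists>!r. is_rate \<alpha> \<delta> r" by (rule ex1_rate)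
  next
    show "AE \<omega> in M. (\<lambda>n. real (vdeg e i n \<omega>) / ln (real n) powr (1 / (1 + \<alpha>)))
        \<longlonglongrightarrow> ((1 + \<alpha>) / ?l) powr (1 / (1 + \<alpha>))"
      by (rule vdeg_limit[OF assms(5)])
  next
    fix k :: nat assume k: "1 \<le> k"
    show "AE \<omega> in M. (\<lambda>n. degree_fraction e k n \<omega>)
        \<longlonglongrightarrow> ((\<delta> + real k) powr \<alpha> * ?l) / ((\<delta> + real k) powr \<alpha> * ?l + 1)
             * (\<Prod>j=1..<k. 1 / ((\<delta> + real j) powr \<alpha> * ?l + 1))"
      unfolding level[OF k] by (rule AE_degree_fraction_limit[OF k])
    show "(\<lambda>n. measure M {\<omega> \<in> space M. \<exists>v\<in>{1..n}. e (Suc n) \<omega> = {Suc n, v} \<and> vdeg e v n \<omega> = k})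
        \<longlonglongrightarrow> (\<Prod>j=1..k. 1 / ((\<delta> + real j) powr \<alpha> * ?l + 1))"
      unfolding prod by (rule attach_level_probability_limit[OF k])
  qed
qed

end
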